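(* There does not exist a $C^\infty$ isometric immersion of the hyperbolic plane $\mathbb{H}^2$ into Euclidean $3$-space $\mathbb{R}^3$.
   Context: The hyperbolic plane $\mathbb{H}^2$ is represented by the Poincaré disk $\mathbb{D} = \{(x,y)\in\mathbb{R}^2 : x^2+y^2<1\}$ with the Riemannian metric $g_{11}=g_{22}=4/(1-x^2-y^2)^2$, $g_{12}=g_{21}=0$ (constant Gaussian curvature $-1$). A $C^\infty$ isometric immersion of $(\mathbb{D},g)$ into $\mathbb{R}^3$ is a $C^\infty$ map $\phi:\mathbb{D}\to\mathbb{R}^3$ such that $\langle d\phi_P(v), d\phi_P(w)\rangle = g_P(v,w)$ for all $P\in\mathbb{D}$ and all $v,w\in T_P\mathbb{D}$, where $\langle\cdot,\cdot\rangle$ is the Euclidean inner product. The map is not required to be injective. *)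

theory Defs
  imports "HOL-Analysis.Analysis"
begin

text \<open>Meant for open \<open>S\<close>: derivatives are taken in the ambient space, at points of \<open>S\<close>, so
  the values of \<open>f\<close> outside \<open>S\<close> are irrelevant. For a Euclidean domain, continuity of
  \<open>\<lambda>x. Df(x) v\<close> for every fixed \<open>v\<close> amounts to continuity of \<open>x \<mapsto> Df(x)\<close>.\<close>

primrec C_k_on :: "nat \<Rightarrow> ('a::euclidean_space \<Rightarrow> 'b::real_normed_vector) \<Rightarrow> 'a set \<Rightarrow> bool" where
  "C_k_on 0 f S \<longleftrightarrow> continuous_on S f"
| "C_k_on (Suc k) f S \<longleftrightarrow>
     (\<forall>x\<in>S. f differentiable (at x)) \<and>
     (\<forall>v. C_k_on k (\<lambda>x. frechet_derivative f (at x) v) S)"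

definition C_infinity_on :: "('a::euclidean_space \<Rightarrow> 'b::real_normed_vector) \<Rightarrow> 'a set \<Rightarrow> bool" where
  "C_infinity_on f S \<longleftrightarrow> (\<forall>k. C_k_on k f S)"

definition poincare_disk :: "(real^2) set" where
  "poincare_disk = {p. (p$1)^2 + (p$2)^2 < 1}"

definition poincare_coeff :: "real^2 \<Rightarrow> real^2^2" where
  "poincare_coeff p = (\<chi> i j. if i = j then 4 / (1 - (p$1)^2 - (p$2)^2)^2 else 0)"

definition poincare_metric :: "real^2 \<Rightarrow> real^2 \<Rightarrow> real^2 \<Rightarrow> real" where
  "poincare_metric p v w = (\<Sum>i\<in>UNIV. \<Sum>j\<in>UNIV. poincare_coeff p $ i $ j * v$i * w$j)"

text \<open>The source is an open \<open>U \<subseteq> \<real>\<^sup>n\<close> with metric \<open>g\<close>; every tangent space is \<open>\<real>\<^sup>n\<close>, and the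
  differential at \<open>p\<close> is the Frechet derivative.\<close>

definition smooth_isometric_immersion ::
  "('a::euclidean_space) set \<Rightarrow> ('a \<Rightarrow> 'a \<Rightarrow> 'a \<Rightarrow> real) \<Rightarrow> ('a \<Rightarrow> 'b::euclidean_space) \<Rightarrow> bool" where
  "smooth_isometric_immersion U g \<phi> \<longleftrightarrow>
     C_infinity_on \<phi> U \<and>
     (\<forall>p\<in>U. \<forall>v w. frechet_derivative \<phi> (at p) v \<bullet> frechet_derivative \<phi> (at p) w = g p v w)"

end

theory Submission
  imports Defs
begin

text \<open>
  On a surface of curvature \<open>-1\<close> the Codazzi equations say that the unit asymptotic directions
  \<open>X, Y\<close> are parallel along each other; the coframe dual to \<open>X, Y\<close> is then closed, and the angle
  \<open>\<Theta>\<close> from \<open>X\<close> to \<open>Y\<close> satisfies \<open>X (Y \<Theta>) = Y (X \<Theta>) = sin \<Theta>\<close>. On the disk the dual coframe has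
  potentials \<open>u, v\<close>, so \<open>F = (u, v)\<close> is a local diffeomorphism into the plane. The inverse of its
  derivative is bounded in the hyperbolic metric, which is complete, so \<open>F\<close> has a section on the whole
  plane. Pulling \<open>\<Theta>\<close> back along it gives a solution of the sine-Gordon equation
  \<open>\<Theta>\<^sub>u\<^sub>v = sin \<Theta>\<close> on the plane with values in \<open>(0, \<pi>)\<close>. There is none: \<open>\<Theta>\<^sub>u\<close> is strictly increasing
  in \<open>v\<close>, so, up to a reflection, \<open>\<Theta>\<close> stays away from \<open>0\<close> and \<open>\<pi>\<close> on some half-strip, on which \<open>\<Theta>\<^sub>u\<close>
  then grows linearly in \<open>v\<close>.
\<close>

section \<open>Smooth functions and closed forms\<close>

text \<open>The local equations do have solutions, for instance on the pseudosphere, so the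
  contradiction has to come from the whole plane. Two facts make the construction global. The disk
  is convex, so closed forms have potentials; this also turns the asymptotic directions, which are
  the zeros of a quadratic form, into angle functions \<open>\<beta>\<close> and
  \<open>\<gamma>\<close> on all of the disk. And although the dual coframe may blow up where
  \<Theta> approaches 0 or pi, the inverse of its matrix sends the coordinate vectors to unit
  vectors, so it is bounded whatever the angle is. Curvature enters twice. Extrinsically, the
  negative determinant of the second fundamental form keeps the two asymptotic directions apart,
  which puts \<Theta> in (0, pi). Intrinsically, the differential of the connection form is the area
  form, which is where the right side sin \<Theta> comes from.\<close>

lemma C_k_on_cong:
  assumes "open S" "\<And>x. x \<in> S \<Longrightarrow> f x = g x"
  shows "C_k_on k f S \<longleftrightarrow> C_k_on k g S"
  using assms(2)
proof (induction k arbitrary: f g)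
  case 0
  then show ?case by (auto intro: continuous_on_cong)
next
  case (Suc k)
  have hd: "(f has_derivative D) (at x) \<longleftrightarrow> (g has_derivative D) (at x)" if "x \<in> S" for x D
    using has_derivative_transform_within_open[OF _ assms(1) that, of f D UNIV g]
      has_derivative_transform_within_open[OF _ assms(1) that, of g D UNIV f] Suc.prems by auto
  then have d: "f differentiable (at x) \<longleftrightarrow> g differentiable (at x)"
    "frechet_derivative f (at x) = frechet_derivative g (at x)" if "x \<in> S" for x
    using that by (simp_all add: differentiable_def frechet_derivative_def)
  have "C_k_on k (\<lambda>x. frechet_derivative f (at x) v) S \<longleftrightarrow> C_k_on k (\<lambda>x. frechet_derivative g (at x) v) S" for v
    by (rule Suc.IH) (simp add: d)
  with d(1) show ?case
    by simp
qed

text \<open>Derivatives at points of an open set are unique, so an explicit derivative may stand in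
  for \<open>frechet_derivative\<close>. The induction steps of the closure rules below rest on
  this.\<close>

lemma C_k_on_SucI:
  assumes "open S" "\<And>x. x \<in> S \<Longrightarrow> (f has_derivative f' x) (at x)"
    and "\<And>v. C_k_on k (\<lambda>x. f' x v) S"
  shows "C_k_on (Suc k) f S"
proof -
  have "C_k_on k (\<lambda>x. frechet_derivative f (at x) v) S" for v
    using C_k_on_cong[OF assms(1), of "\<lambda>x. frechet_derivative f (at x) v" "\<lambda>x. f' x v"]
      frechet_derivative_at[OF assms(2)] assms(3) by metis
  then show ?thesis using assms(2) by (auto simp: differentiable_def)
qed

lemma C_k_on_SucD:
  assumes "C_k_on (Suc k) f S"
  shows "x \<in> S \<Longrightarrow> (f has_derivative frechet_derivative f (at x)) (at x)"
    and "C_k_on k (\<lambda>x. frechet_derivative f (at x) v) S"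
  using assms by (auto simp: frechet_derivative_works)

text \<open>The successor clause of \<open>C_k_on\<close> does not mention continuity of
  \<open>f\<close>; at order 0 it comes from differentiability.\<close>

lemma C_k_on_Suc_imp:
  "C_k_on (Suc k) f S \<Longrightarrow> C_k_on k f S"
proof (induction k arbitrary: f)
  case 0
  then show ?case
    by (auto intro!: continuous_at_imp_continuous_on differentiable_imp_continuous_within)
next
  case (Suc k)
  then show ?case by (metis C_k_on.simps(2))
qed

lemma C_k_on_const: "open S \<Longrightarrow> C_k_on k (\<lambda>x. c) S"
proof (induction k arbitrary: c)
  case (Suc k)
  show ?case
    by (rule C_k_on_SucI[where f' = "\<lambda>x v. 0"]) (auto intro!: Suc)
qed auto

lemma C_k_on_add:
  assumes "open S" "C_k_on k f S" "C_k_on k g S"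
  shows "C_k_on k (\<lambda>x. f x + g x) S"
  using assms(2,3)
proof (induction k arbitrary: f g)
  case (Suc k)
  show ?case
    by (rule C_k_on_SucI[OF assms(1), where f' = "\<lambda>x v. frechet_derivative f (at x) v + frechet_derivative g (at x) v"])
      (auto intro!: has_derivative_add Suc.IH C_k_on_SucD Suc.prems simp del: C_k_on.simps(2))
qed (auto intro: continuous_intros)

text \<open>One rule for products, scaling, inner and cross products. In the Leibniz rule the
  undifferentiated factor is needed one order lower, hence \<open>C_k_on_Suc_imp\<close>.\<close>

lemma C_k_on_bilinear:
  assumes "bounded_bilinear prd" "open S" "C_k_on k f S" "C_k_on k g S"
  shows "C_k_on k (\<lambda>x. prd (f x) (g x)) S"
  using assms(3,4)
proof (induction k arbitrary: f g)
  case 0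
  then show ?case by (auto intro: bounded_bilinear.continuous_on[OF assms(1)])
next
  case (Suc k)
  note fg = Suc.prems[THEN C_k_on_Suc_imp]
  have "C_k_on k (\<lambda>x. prd (f x) (frechet_derivative g (at x) v) + prd (frechet_derivative f (at x) v) (g x)) S" for v
    by (rule C_k_on_add[OF assms(2) Suc.IH[OF fg(1) C_k_on_SucD(2)[OF Suc.prems(2)]]
        Suc.IH[OF C_k_on_SucD(2)[OF Suc.prems(1)] fg(2)]])
  with bounded_bilinear.FDERIV[OF assms(1) C_k_on_SucD(1)[OF Suc.prems(1)] C_k_on_SucD(1)[OF Suc.prems(2)]]
  show ?case
    by (rule C_k_on_SucI[OF assms(2)])
qed

lemma C_k_on_linear:
  assumes "bounded_linear h" "open S" "C_k_on k f S"
  shows "C_k_on k (\<lambda>x. h (f x)) S"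
  using assms(3)
proof (induction k arbitrary: f)
  case 0
  then show ?case by (auto intro: bounded_linear.continuous_on[OF assms(1)])
next
  case (Suc k)
  show ?case
    by (rule C_k_on_SucI[OF assms(2), where f' = "\<lambda>x v. h (frechet_derivative f (at x) v)"])
      (auto intro!: bounded_linear.has_derivative[OF assms(1)]
        Suc.IH C_k_on_SucD Suc.prems simp del: C_k_on.simps(2))
qed

lemma C_k_on_id: "open S \<Longrightarrow> C_k_on k (\<lambda>x. x) S"
proof (cases k)
  case (Suc j)
  assume "open S"
  then show ?thesis
    unfolding Suc by (intro C_k_on_SucI[where f' = "\<lambda>x v. v"] has_derivative_ident C_k_on_const)
qed auto

text \<open>The derivative of \<open>inverse f\<close> contains \<open>inverse f\<close> again, but
  only to order \<open>k\<close>, where the induction hypothesis supplies it.\<close>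

lemma C_k_on_inverse:
  fixes f :: "'a::euclidean_space \<Rightarrow> real"
  assumes "open S" "C_k_on k f S" "\<And>x. x \<in> S \<Longrightarrow> f x \<noteq> 0"
  shows "C_k_on k (\<lambda>x. inverse (f x)) S"
  using assms(2)
proof (induction k)
  case 0
  then show ?case using assms(3) by (auto intro: continuous_intros)
next
  case (Suc k)
  have "C_k_on k (\<lambda>x. inverse (f x)) S" using Suc C_k_on_Suc_imp by blast
  then have 1: "C_k_on k (\<lambda>x. (-1) * (inverse (f x) * frechet_derivative f (at x) v * inverse (f x))) S" for v
    by (intro C_k_on_bilinear[OF bounded_bilinear_mult] assms(1) C_k_on_const C_k_on_SucD(2)[OF Suc.prems])
  have 2: "((\<lambda>x. inverse (f x)) has_derivative
      (\<lambda>v. (-1) * (inverse (f x) * frechet_derivative f (at x) v * inverse (f x)))) (at x)" if "x \<in> S" for x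
    using Deriv.has_derivative_inverse[OF assms(3)[OF that] C_k_on_SucD(1)[OF Suc.prems that]] by simp
  show ?case
    by (rule C_k_on_SucI[OF assms(1) 2 1])
qed

text \<open>The two are proved together because each occurs in the derivative of the other.\<close>

lemma C_k_on_sin_cos:
  fixes f :: "'a::euclidean_space \<Rightarrow> real"
  assumes "open S" "C_k_on k f S"
  shows "C_k_on k (\<lambda>x. sin (f x)) S \<and> C_k_on k (\<lambda>x. cos (f x)) S"
  using assms(2)
proof (induction k)
  case 0
  then show ?case by (auto intro: continuous_intros)
next
  case (Suc k)
  have *: "C_k_on k (\<lambda>x. sin (f x)) S" "C_k_on k (\<lambda>x. cos (f x)) S" using Suc C_k_on_Suc_imp by blast+
  then have **: "C_k_on k (\<lambda>x. frechet_derivative f (at x) v * cos (f x)) S"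
      "C_k_on k (\<lambda>x. frechet_derivative f (at x) v * ((-1) * sin (f x))) S" for v
    by (intro C_k_on_bilinear[OF bounded_bilinear_mult] assms(1) C_k_on_const C_k_on_SucD(2)[OF Suc.prems]; simp)+
  have "((\<lambda>x. sin (f x)) has_derivative (\<lambda>v. frechet_derivative f (at x) v * cos (f x))) (at x)"
    "((\<lambda>x. cos (f x)) has_derivative (\<lambda>v. frechet_derivative f (at x) v * ((-1) * sin (f x)))) (at x)"
    if "x \<in> S" for x
    using DERIV_compose_FDERIV[OF DERIV_sin C_k_on_SucD(1)[OF Suc.prems that]]
      DERIV_compose_FDERIV[OF DERIV_cos C_k_on_SucD(1)[OF Suc.prems that]] by simp_all
  from C_k_on_SucI[OF assms(1) this(1) **(1)] C_k_on_SucI[OF assms(1) this(2) **(2)]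
  show ?case by blast
qed

text \<open>No induction: the derivative is rational in \<open>f\<close> and its derivative, so the
  earlier rules cover it.\<close>

lemma C_k_on_arctan:
  fixes f :: "'a::euclidean_space \<Rightarrow> real"
  assumes "open S" "C_k_on k f S"
  shows "C_k_on k (\<lambda>x. arctan (f x)) S"
proof (cases k)
  case 0
  then show ?thesis using assms by (auto intro: continuous_intros)
next
  case (Suc j)
  have f: "C_k_on j f S" using assms Suc C_k_on_Suc_imp by blast
  have "1 + f x * f x \<noteq> 0" for x
    using add_pos_nonneg[of 1 "f x * f x"] by auto
  then have 1: "C_k_on j (\<lambda>x. frechet_derivative f (at x) v * inverse (1 + f x * f x)) S" for v
    using assms Suc
    by (intro C_k_on_bilinear[OF bounded_bilinear_mult] C_k_on_inverse C_k_on_add C_k_on_const assms(1) f C_k_on_SucD(2)) auto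
  have 2: "((\<lambda>x. arctan (f x)) has_derivative
      (\<lambda>v. frechet_derivative f (at x) v * inverse (1 + f x * f x))) (at x)" if "x \<in> S" for x
    using DERIV_compose_FDERIV[OF DERIV_arctan C_k_on_SucD(1)[OF assms(2)[unfolded Suc] that]]
    by (simp add: power2_eq_square)
  show ?thesis
    unfolding Suc by (rule C_k_on_SucI[OF assms(1) 2 1])
qed

lemma C_infinity_onD:
  assumes "C_infinity_on f S"
  shows "x \<in> S \<Longrightarrow> (f has_derivative frechet_derivative f (at x)) (at x)"
    and "C_infinity_on (\<lambda>x. frechet_derivative f (at x) v) S"
    and "continuous_on S f"
  using assms C_k_on_SucD C_k_on.simps(1) unfolding C_infinity_on_def by blast+

lemma C_infinity_onI:
  assumes "open S" "\<And>x. x \<in> S \<Longrightarrow> (f has_derivative f' x) (at x)"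
    and "\<And>v. C_infinity_on (\<lambda>x. f' x v) S"
  shows "C_infinity_on f S"
  unfolding C_infinity_on_def
proof
  fix k
  have "C_k_on (Suc k) f S"
    using assms by (intro C_k_on_SucI[of S f f' k]) (auto simp: C_infinity_on_def)
  then show "C_k_on k f S" by (rule C_k_on_Suc_imp)
qed

section \<open>Closure rules for smooth functions\<close>

named_theorems smooth_intros

context
  fixes S :: "'a::euclidean_space set"
  assumes S: "open S"
begin

lemma C_infinity_on_const [smooth_intros]: "C_infinity_on (\<lambda>x. c) S"
  by (simp add: C_infinity_on_def C_k_on_const S)

lemma C_infinity_on_id [smooth_intros]: "C_infinity_on (\<lambda>x. x) S"
  by (simp add: C_infinity_on_def C_k_on_id S)

lemma C_infinity_on_linear:
  "bounded_linear h \<Longrightarrow> C_infinity_on f S \<Longrightarrow> C_infinity_on (\<lambda>x. h (f x)) S"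
  by (simp add: C_infinity_on_def C_k_on_linear S)

lemma C_infinity_on_bilinear:
  "bounded_bilinear prd \<Longrightarrow> C_infinity_on f S \<Longrightarrow> C_infinity_on g S \<Longrightarrow> C_infinity_on (\<lambda>x. prd (f x) (g x)) S"
  by (simp add: C_infinity_on_def C_k_on_bilinear S)

lemma C_infinity_on_add [smooth_intros]:
  "C_infinity_on f S \<Longrightarrow> C_infinity_on g S \<Longrightarrow> C_infinity_on (\<lambda>x. f x + g x) S"
  by (simp add: C_infinity_on_def C_k_on_add S)

lemmas C_infinity_on_minus [smooth_intros] = C_infinity_on_linear[OF bounded_linear_minus[OF bounded_linear_ident]]
  and C_infinity_on_component [smooth_intros] = C_infinity_on_linear[OF bounded_linear_vec_nth]
  and C_infinity_on_mult [smooth_intros] = C_infinity_on_bilinear[OF bounded_bilinear_mult]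
  and C_infinity_on_scaleR [smooth_intros] = C_infinity_on_bilinear[OF bounded_bilinear_scaleR]
  and C_infinity_on_inner [smooth_intros] = C_infinity_on_bilinear[OF bounded_bilinear_inner]
  and C_infinity_on_cross3 [smooth_intros] =
    C_infinity_on_bilinear[OF bilinear_cross[unfolded bilinear_conv_bounded_bilinear]]

lemma C_infinity_on_diff [smooth_intros]:
  fixes f :: "'a \<Rightarrow> 'b::real_normed_vector"
  shows "C_infinity_on f S \<Longrightarrow> C_infinity_on g S \<Longrightarrow> C_infinity_on (\<lambda>x. f x - g x) S"
  using C_infinity_on_add[OF _ C_infinity_on_minus, of f g] by simp

lemma C_infinity_on_power [smooth_intros]:
  fixes f :: "'a \<Rightarrow> real"
  shows "C_infinity_on f S \<Longrightarrow> C_infinity_on (\<lambda>x. f x ^ n) S"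
  by (induction n) (auto intro: smooth_intros)

lemma C_infinity_on_divide [smooth_intros]:
  fixes f :: "'a \<Rightarrow> real"
  shows "C_infinity_on f S \<Longrightarrow> C_infinity_on g S \<Longrightarrow> (\<And>x. x \<in> S \<Longrightarrow> g x \<noteq> 0)
    \<Longrightarrow> C_infinity_on (\<lambda>x. f x / g x) S"
  unfolding divide_inverse
  by (intro C_infinity_on_mult) (auto simp: C_infinity_on_def C_k_on_inverse S)

lemma C_infinity_on_sin [smooth_intros]: "C_infinity_on f S \<Longrightarrow> C_infinity_on (\<lambda>x. sin (f x :: real)) S"
  and C_infinity_on_cos [smooth_intros]: "C_infinity_on f S \<Longrightarrow> C_infinity_on (\<lambda>x. cos (f x :: real)) S"
  and C_infinity_on_arctan [smooth_intros]: "C_infinity_on f S \<Longrightarrow> C_infinity_on (\<lambda>x. arctan (f x)) S"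
  by (simp_all add: C_infinity_on_def C_k_on_sin_cos C_k_on_arctan S)

end

text \<open>Two mean value theorems, first along \<open>v\<close> for the difference in direction
  \<open>w\<close>, then along \<open>w\<close> for the derivative. The second difference itself is
  symmetric in \<open>v\<close> and \<open>w\<close>.\<close>

lemma second_difference_mean_value:
  fixes f :: "'a::real_normed_vector \<Rightarrow> real"
  assumes h: "h > 0" and sub: "\<And>s t. 0 \<le> s \<Longrightarrow> s \<le> h \<Longrightarrow> 0 \<le> t \<Longrightarrow> t \<le> h \<Longrightarrow> p + s *\<^sub>R v + t *\<^sub>R w \<in> S"
    and f: "\<And>x. x \<in> S \<Longrightarrow> (f has_derivative f' x) (at x)"
    and g: "\<And>x. x \<in> S \<Longrightarrow> ((\<lambda>x. f' x v) has_derivative g' x) (at x)"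
  obtains s t where "0 \<le> s" "s \<le> h" "0 \<le> t" "t \<le> h"
    "f (p + h *\<^sub>R v + h *\<^sub>R w) - f (p + h *\<^sub>R v) - f (p + h *\<^sub>R w) + f p = h\<^sup>2 * g' (p + s *\<^sub>R v + t *\<^sub>R w) w"
proof -
  have 1: "((\<lambda>s. f (p + s *\<^sub>R v + t *\<^sub>R w)) has_real_derivative f' (p + s *\<^sub>R v + t *\<^sub>R w) v) (at s)"
    if "0 \<le> s" "s \<le> h" "0 \<le> t" "t \<le> h" for s t
  proof -
    have "((\<lambda>s. f (p + s *\<^sub>R v + t *\<^sub>R w)) has_derivative (\<lambda>k. f' (p + s *\<^sub>R v + t *\<^sub>R w) (k *\<^sub>R v))) (at s)"
      by (rule has_derivative_compose[where g = f and f = "\<lambda>s. p + s *\<^sub>R v + t *\<^sub>R w", OF _ f[OF sub[OF that]]]) (auto intro!: derivative_eq_intros)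
    then show ?thesis
      by (rule has_derivative_imp_has_field_derivative)
        (simp add: linear_cmul[OF has_derivative_linear[OF f[OF sub[OF that]]]])
  qed
  have "\<exists>s>0. s < h \<and> (f (p + h *\<^sub>R v + h *\<^sub>R w) - f (p + h *\<^sub>R v + 0 *\<^sub>R w)) - (f (p + 0 *\<^sub>R v + h *\<^sub>R w) - f (p + 0 *\<^sub>R v + 0 *\<^sub>R w))
     = (h - 0) * (f' (p + s *\<^sub>R v + h *\<^sub>R w) v - f' (p + s *\<^sub>R v + 0 *\<^sub>R w) v)"
    using h by (intro MVT2 DERIV_diff 1) auto
  then obtain s where s: "0 < s" "s < h"
    "f (p + h *\<^sub>R v + h *\<^sub>R w) - f (p + h *\<^sub>R v) - f (p + h *\<^sub>R w) + f p
     = h * (f' (p + s *\<^sub>R v + h *\<^sub>R w) v - f' (p + s *\<^sub>R v + 0 *\<^sub>R w) v)" by auto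
  have "((\<lambda>t. f' (p + s *\<^sub>R v + t *\<^sub>R w) v) has_real_derivative g' (p + s *\<^sub>R v + t *\<^sub>R w) w) (at t)"
    if "0 \<le> t" "t \<le> h" for t
  proof -
    have *: "p + s *\<^sub>R v + t *\<^sub>R w \<in> S" using s that by (intro sub) auto
    have "((\<lambda>t. f' (p + s *\<^sub>R v + t *\<^sub>R w) v) has_derivative (\<lambda>k. g' (p + s *\<^sub>R v + t *\<^sub>R w) (k *\<^sub>R w))) (at t)"
      by (rule has_derivative_compose[where g = "\<lambda>x. f' x v" and f = "\<lambda>t. p + s *\<^sub>R v + t *\<^sub>R w", OF _ g[OF *]]) (auto intro!: derivative_eq_intros)
    then show ?thesis
      by (rule has_derivative_imp_has_field_derivative)
        (simp add: linear_cmul[OF has_derivative_linear[OF g[OF *]]])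
  qed
  then have "\<exists>t>0. t < h \<and> f' (p + s *\<^sub>R v + h *\<^sub>R w) v - f' (p + s *\<^sub>R v + 0 *\<^sub>R w) v
      = (h - 0) * g' (p + s *\<^sub>R v + t *\<^sub>R w) w"
    using h by (intro MVT2) auto
  then obtain t where "0 < t" "t < h" "f' (p + s *\<^sub>R v + h *\<^sub>R w) v - f' (p + s *\<^sub>R v + 0 *\<^sub>R w) v
      = h * g' (p + s *\<^sub>R v + t *\<^sub>R w) w" by auto
  with s that[of s t] show thesis by (simp add: power2_eq_square)
qed

text \<open>Schwarz's theorem: the second difference over a small parallelogram, divided by
  \<open>k\<^sup>2\<close>, is a value of either mixed derivative in that parallelogram, and both
  are continuous at \<open>p\<close>.\<close>

lemma symmetric_second_derivative_real:
  fixes f :: "'a::real_normed_vector \<Rightarrow> real"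
  assumes "open S" "p \<in> S"
    and f: "\<And>x. x \<in> S \<Longrightarrow> (f has_derivative f' x) (at x)"
    and g: "\<And>x. x \<in> S \<Longrightarrow> ((\<lambda>x. f' x v) has_derivative g' x) (at x)"
    and h: "\<And>x. x \<in> S \<Longrightarrow> ((\<lambda>x. f' x w) has_derivative h' x) (at x)"
    and cont: "continuous_on S (\<lambda>x. g' x w)" "continuous_on S (\<lambda>x. h' x v)"
  shows "g' p w = h' p v"
proof (rule ccontr)
  assume ne: "g' p w \<noteq> h' p v"
  \<comment> \<open>Half the gap, so that no number is within \<open>e\<close> of both
    values.\<close>
  define e where "e = \<bar>g' p w - h' p v\<bar> / 2"
  have "e > 0" using ne by (simp add: e_def)
  have "isCont (\<lambda>x. g' x w) p" "isCont (\<lambda>x. h' x v) p"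
    using cont assms(1,2) by (auto simp: continuous_on_eq_continuous_at)
  then obtain d1 d2 where d: "d1 > 0" "\<And>x. dist x p < d1 \<Longrightarrow> \<bar>g' x w - g' p w\<bar> < e"
     "d2 > 0" "\<And>x. dist x p < d2 \<Longrightarrow> \<bar>h' x v - h' p v\<bar> < e"
    using \<open>e > 0\<close> unfolding continuous_at_eps_delta dist_real_def by metis
  obtain d3 where d3: "d3 > 0" "ball p d3 \<subseteq> S" using assms(1,2) by (meson openE)
  define d where "d = min d1 (min d2 d3)"
  \<comment> \<open>This keeps the parallelogram spanned by \<open>k v\<close> and
    \<open>k w\<close> within distance \<open>d\<close> of \<open>p\<close>; the summand 1 covers
    \<open>v = w = 0\<close>.\<close>
  define k where "k = d / (norm v + norm w + 1)"
  have nz: "norm v + norm w + 1 > 0" by (simp add: add_nonneg_pos)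
  have "d > 0" using d d3 by (simp add: d_def)
  then have k: "k > 0" using nz by (simp add: k_def)
  have near: "dist (p + s *\<^sub>R v + t *\<^sub>R w) p < d" if "0 \<le> s" "s \<le> k" "0 \<le> t" "t \<le> k" for s t
  proof -
    have "dist (p + s *\<^sub>R v + t *\<^sub>R w) p = norm (s *\<^sub>R v + t *\<^sub>R w)" by (simp add: dist_norm)
    also have "\<dots> \<le> s * norm v + t * norm w"
      using norm_triangle_ineq[of "s *\<^sub>R v" "t *\<^sub>R w"] that by simp
    also have "\<dots> \<le> k * norm v + k * norm w"
      using that by (intro add_mono mult_right_mono) auto
    also have "\<dots> < k * (norm v + norm w + 1)" using k by (simp add: algebra_simps)
    also have "\<dots> = d" using nz by (simp add: k_def)
    finally show ?thesis .
  qed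
  then have S: "p + s *\<^sub>R v + t *\<^sub>R w \<in> S" "p + t *\<^sub>R w + s *\<^sub>R v \<in> S"
    if "0 \<le> s" "s \<le> k" "0 \<le> t" "t \<le> k" for s t
  proof -
    show *: "p + s *\<^sub>R v + t *\<^sub>R w \<in> S"
      using near[OF that] d3(2) by (auto simp: d_def dist_commute)
    then show "p + t *\<^sub>R w + s *\<^sub>R v \<in> S" by (simp add: algebra_simps)
  qed
  obtain s t where 1: "0 \<le> s" "s \<le> k" "0 \<le> t" "t \<le> k"
    "f (p + k *\<^sub>R v + k *\<^sub>R w) - f (p + k *\<^sub>R v) - f (p + k *\<^sub>R w) + f p = k\<^sup>2 * g' (p + s *\<^sub>R v + t *\<^sub>R w) w"
    using k S(1) f g by (rule second_difference_mean_value[of k p v w S f f' g']) blast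
  obtain t' s' where 2: "0 \<le> s'" "s' \<le> k" "0 \<le> t'" "t' \<le> k"
    "f (p + k *\<^sub>R w + k *\<^sub>R v) - f (p + k *\<^sub>R w) - f (p + k *\<^sub>R v) + f p = k\<^sup>2 * h' (p + t' *\<^sub>R w + s' *\<^sub>R v) v"
    using k S(2) f h by (rule second_difference_mean_value[of k p w v S f f' h']) blast
  have "k\<^sup>2 * g' (p + s *\<^sub>R v + t *\<^sub>R w) w = k\<^sup>2 * h' (p + s' *\<^sub>R v + t' *\<^sub>R w) v"
    using 1(5) 2(5) by (simp add: algebra_simps)
  then have "g' (p + s *\<^sub>R v + t *\<^sub>R w) w = h' (p + s' *\<^sub>R v + t' *\<^sub>R w) v" using k by simp
  moreover have "\<bar>g' (p + s *\<^sub>R v + t *\<^sub>R w) w - g' p w\<bar> < e" "\<bar>h' (p + s' *\<^sub>R v + t' *\<^sub>R w) v - h' p v\<bar> < e"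
    using near[OF 1(1-4)] near[OF 2(1-4)] by (auto intro!: d(2,4) simp: d_def)
  ultimately show False unfolding e_def by argo
qed

lemma symmetric_second_derivative:
  fixes f :: "'a::euclidean_space \<Rightarrow> 'b::euclidean_space"
  assumes "C_infinity_on f S" "open S" "p \<in> S"
  shows "frechet_derivative (\<lambda>x. frechet_derivative f (at x) v) (at p) w
    = frechet_derivative (\<lambda>x. frechet_derivative f (at x) w) (at p) v"
proof (rule euclidean_eqI)
  fix b :: 'b
  let ?d = "\<lambda>f v x. frechet_derivative f (at x) v"
  have f: "((\<lambda>x. f x \<bullet> b) has_derivative (\<lambda>v. ?d f v x \<bullet> b)) (at x)" if "x \<in> S" for x
    by (rule has_derivative_inner_left[OF C_infinity_onD(1)[OF assms(1) that]])
  have d: "((\<lambda>x. ?d f v x \<bullet> b) has_derivative (\<lambda>w. ?d (?d f v) w x \<bullet> b)) (at x)" if "x \<in> S" for x v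
    by (rule has_derivative_inner_left[OF C_infinity_onD(1)[OF C_infinity_onD(2)[OF assms(1)] that]])
  have c: "continuous_on S (\<lambda>x. ?d (?d f v) w x \<bullet> b)" for v w
    by (rule continuous_on_inner[OF C_infinity_onD(3)[OF C_infinity_onD(2)[OF C_infinity_onD(2)[OF assms(1)]]] continuous_on_const])
  show "?d (?d f v) w p \<bullet> b = ?d (?d f w) v p \<bullet> b"
    by (rule symmetric_second_derivative_real[OF assms(2,3) f d d c c])
qed

text \<open>Poincare lemma: the potential is the integral of \<open>\<eta> (t p) \<bullet> p\<close>
  over \<open>t\<close> in [0, 1]. Closedness turns the \<open>v\<close>-derivative of the integrand
  into \<open>G p t \<bullet> v\<close>, and \<open>G p\<close> integrates to
  \<open>\<eta> p\<close>.\<close>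

lemma closed_field_has_potential:
  fixes \<eta> :: "'a::euclidean_space \<Rightarrow> 'a"
  assumes S: "open S" "convex S" "0 \<in> S"
    and \<eta>: "\<And>p. p \<in> S \<Longrightarrow> (\<eta> has_derivative \<eta>' p) (at p)"
    and cont: "\<And>v. continuous_on S (\<lambda>p. \<eta>' p v)"
    and closed: "\<And>p v w. p \<in> S \<Longrightarrow> \<eta>' p v \<bullet> w = \<eta>' p w \<bullet> v"
  obtains s where "\<And>p. p \<in> S \<Longrightarrow> (s has_derivative (\<lambda>v. \<eta> p \<bullet> v)) (at p)"
proof -
  have in_S: "t *\<^sub>R p \<in> S" if "p \<in> S" "0 \<le> t" "t \<le> 1" for t p
    using convexD[OF S(2) that(1) S(3), of t "1 - t"] that by simp
  \<comment> \<open>The \<open>t\<close>-derivative of \<open>t \<eta> (t p)\<close>.\<close>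
  define G where "G p t = \<eta> (t *\<^sub>R p) + t *\<^sub>R \<eta>' (t *\<^sub>R p) p" for p t
  have lin: "linear (\<eta>' p)" if "p \<in> S" for p
    using \<eta>[OF that] has_derivative_linear by blast
  have cont_\<eta>: "continuous_on S \<eta>"
    using \<eta> has_derivative_continuous by (blast intro: continuous_at_imp_continuous_on)
  have 1: "((\<lambda>p. \<eta> (t *\<^sub>R p) \<bullet> p) has_derivative blinfun_inner_left (G p t)) (at p within S)"
    if "p \<in> S" "t \<in> cbox 0 1" for p t
  proof -
    have tp: "t *\<^sub>R p \<in> S" using in_S that by auto
    have "((\<lambda>p. \<eta> (t *\<^sub>R p)) has_derivative (\<lambda>v. \<eta>' (t *\<^sub>R p) (t *\<^sub>R v))) (at p)"
      by (rule has_derivative_compose[where g = \<eta> and f = "\<lambda>p. t *\<^sub>R p", OF _ \<eta>[OF tp]]) (auto intro!: derivative_eq_intros)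
    from has_derivative_inner[OF this has_derivative_ident]
    have "((\<lambda>p. \<eta> (t *\<^sub>R p) \<bullet> p) has_derivative
        (\<lambda>v. \<eta> (t *\<^sub>R p) \<bullet> v + \<eta>' (t *\<^sub>R p) (t *\<^sub>R v) \<bullet> p)) (at p)" .
    moreover have "(\<lambda>v. \<eta> (t *\<^sub>R p) \<bullet> v + \<eta>' (t *\<^sub>R p) (t *\<^sub>R v) \<bullet> p) = blinfun_inner_left (G p t)"
      using closed[OF tp, of _ p]
      by (auto simp: G_def inner_simps linear_cmul[OF lin[OF tp]] inner_commute)
    ultimately show ?thesis using has_derivative_at_withinI by metis
  qed
  have G: "continuous_on (S \<times> cbox 0 1) (\<lambda>(p, t). G p t)"
  proof -
    \<comment> \<open>Continuity of \<open>\<eta>'\<close> is known only for a fixed direction,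
      whereas here the direction is \<open>p\<close> itself; expanding \<open>p\<close> in the basis
      fixes the directions.\<close>
    have eq: "G p t = \<eta> (t *\<^sub>R p) + t *\<^sub>R (\<Sum>b\<in>Basis. (p \<bullet> b) *\<^sub>R \<eta>' (t *\<^sub>R p) b)"
      if "p \<in> S" "t \<in> cbox 0 1" for p t
    proof -
      have tp: "t *\<^sub>R p \<in> S" using in_S that by auto
      have "\<eta>' (t *\<^sub>R p) p = \<eta>' (t *\<^sub>R p) (\<Sum>b\<in>Basis. (p \<bullet> b) *\<^sub>R b)" by (simp add: euclidean_representation)
      also have "\<dots> = (\<Sum>b\<in>Basis. (p \<bullet> b) *\<^sub>R \<eta>' (t *\<^sub>R p) b)"
        by (simp only: linear_sum[OF lin[OF tp]] linear_cmul[OF lin[OF tp]])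
      finally show ?thesis by (simp add: G_def)
    qed
    have sub: "(\<lambda>x. snd x *\<^sub>R fst x) ` (S \<times> cbox 0 1) \<subseteq> S" using in_S by auto
    have "continuous_on (S \<times> cbox 0 1) (\<lambda>x::'a \<times> real. \<eta> (snd x *\<^sub>R fst x) +
        snd x *\<^sub>R (\<Sum>b\<in>Basis. (fst x \<bullet> b) *\<^sub>R \<eta>' (snd x *\<^sub>R fst x) b))"
      by (intro continuous_intros continuous_on_compose2[OF cont_\<eta> _ sub] continuous_on_compose2[OF cont _ sub])
    then show ?thesis
      by (rule continuous_on_eq) (auto simp: eq)
  qed
  have G1: "continuous_on {0..1} (G p)" if "p \<in> S" for p
  proof -
    have "continuous_on {0..1} (Pair p :: real \<Rightarrow> _)" by (intro continuous_intros)
    from continuous_on_compose2[OF G this] that show ?thesis by auto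
  qed
  have G2: "integral (cbox 0 1) (G p) = \<eta> p" if "p \<in> S" for p
  proof -
    have "((\<lambda>t. t *\<^sub>R \<eta> (t *\<^sub>R p)) has_vector_derivative G p t) (at t within {0..1})" if t: "t \<in> {0..1}" for t
    proof -
      have tp: "t *\<^sub>R p \<in> S" using in_S \<open>p \<in> S\<close> t by auto
      have "((\<lambda>t. \<eta> (t *\<^sub>R p)) has_derivative (\<lambda>k. \<eta>' (t *\<^sub>R p) (k *\<^sub>R p))) (at t)"
        by (rule has_derivative_compose[where g = \<eta> and f = "\<lambda>t. t *\<^sub>R p", OF _ \<eta>[OF tp]]) (auto intro!: derivative_eq_intros)
      then have "((\<lambda>t. \<eta> (t *\<^sub>R p)) has_vector_derivative \<eta>' (t *\<^sub>R p) p) (at t within {0..1})"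
        by (simp add: has_vector_derivative_def linear_cmul[OF lin[OF tp]] has_derivative_at_withinI)
      from has_vector_derivative_scaleR[OF _ this, of "\<lambda>t. t" 1]
      show ?thesis by (simp add: G_def add.commute)
    qed
    from fundamental_theorem_of_calculus[OF _ this]
    have "(G p has_integral \<eta> p) {0..1}" by simp
    then show ?thesis by (simp add: integral_unique)
  qed
  have "((\<lambda>p. integral (cbox 0 1) (\<lambda>t. \<eta> (t *\<^sub>R p) \<bullet> p)) has_derivative (\<lambda>v. \<eta> p \<bullet> v)) (at p)" if p: "p \<in> S" for p
  proof -
    have "((\<lambda>p. integral (cbox 0 1) (\<lambda>t. \<eta> (t *\<^sub>R p) \<bullet> p)) has_derivative
        integral (cbox 0 1) (\<lambda>t. blinfun_inner_left (G p t))) (at p within S)"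
    proof (rule leibniz_rule[OF 1 _ _ p S(2)])
      fix p assume p: "p \<in> S"
      have "(\<lambda>t. t *\<^sub>R p) ` cbox 0 1 \<subseteq> S" using in_S p by auto
      then show "(\<lambda>t. \<eta> (t *\<^sub>R p) \<bullet> p) integrable_on cbox 0 1"
        by (intro integrable_continuous continuous_intros continuous_on_compose2[OF cont_\<eta>])
    next
      show "continuous_on (S \<times> cbox 0 1) (\<lambda>(p, t). blinfun_inner_left (G p t))"
        using bounded_linear.continuous_on[OF bounded_linear_blinfun_inner_left G] by (simp add: split_beta)
    qed
    moreover have "integral (cbox 0 1) (\<lambda>t. blinfun_inner_left (G p t)) = blinfun_inner_left (\<eta> p)"
      using integral_linear[OF integrable_continuous_real[OF G1[OF p]] bounded_linear_blinfun_inner_left] G2[OF p]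
      by (simp add: o_def)
    ultimately show ?thesis
      using at_within_open[OF p S(1)] by (simp add: inner_commute)
  qed
  then show thesis by (rule that)
qed

text \<open>The form is represented by the field \<open>\<eta>\<close> with
  \<open>\<eta> p \<bullet> v = \<omega> p v\<close>. Smoothness of the potential is inherited from
  its derivative \<open>\<omega>\<close>.\<close>

lemma closed_form_has_potential:
  fixes \<omega> :: "'a::euclidean_space \<Rightarrow> 'a \<Rightarrow> real"
  assumes S: "open S" "convex S" "0 \<in> S"
    and lin: "\<And>p. p \<in> S \<Longrightarrow> linear (\<omega> p)"
    and smooth: "\<And>v. C_infinity_on (\<lambda>p. \<omega> p v) S"
    and closed: "\<And>p v w. p \<in> S \<Longrightarrow>
      frechet_derivative (\<lambda>p. \<omega> p v) (at p) w = frechet_derivative (\<lambda>p. \<omega> p w) (at p) v"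
  obtains s where "C_infinity_on s S" "\<And>p. p \<in> S \<Longrightarrow> (s has_derivative \<omega> p) (at p)"
proof -
  define \<eta> where "\<eta> p = (\<Sum>b\<in>Basis. \<omega> p b *\<^sub>R b)" for p
  define \<eta>' where "\<eta>' p v = (\<Sum>b\<in>Basis. frechet_derivative (\<lambda>p. \<omega> p b) (at p) v *\<^sub>R b)" for p v
  note d = C_infinity_onD(1)[OF smooth]
  have rep: "\<omega> p w = (\<Sum>b\<in>Basis. (w \<bullet> b) * \<omega> p b)" if "p \<in> S" for p w
  proof -
    have "\<omega> p w = \<omega> p (\<Sum>b\<in>Basis. (w \<bullet> b) *\<^sub>R b)" by (simp add: euclidean_representation)
    also have "\<dots> = (\<Sum>b\<in>Basis. (w \<bullet> b) * \<omega> p b)"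
      by (simp only: linear_sum[OF lin[OF that]] linear_cmul[OF lin[OF that]] real_scaleR_def)
    finally show ?thesis .
  qed
  have \<eta>_inner: "\<eta> p \<bullet> w = \<omega> p w" if "p \<in> S" for p w
    unfolding rep[OF that, of w] \<eta>_def inner_sum_left by (simp add: inner_commute mult.commute)
  have \<eta>'_inner: "\<eta>' p v \<bullet> w = frechet_derivative (\<lambda>p. \<omega> p w) (at p) v" if "p \<in> S" for p v w
  proof -
    have "((\<lambda>p. \<Sum>b\<in>Basis. (w \<bullet> b) * \<omega> p b) has_derivative
        (\<lambda>v. \<Sum>b\<in>Basis. (w \<bullet> b) * frechet_derivative (\<lambda>p. \<omega> p b) (at p) v)) (at p)"
      by (intro has_derivative_sum has_derivative_mult_right d[OF that])
    then have "((\<lambda>p. \<omega> p w) has_derivative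
        (\<lambda>v. \<Sum>b\<in>Basis. (w \<bullet> b) * frechet_derivative (\<lambda>p. \<omega> p b) (at p) v)) (at p)"
      by (rule has_derivative_transform_within_open[OF _ S(1) that]) (simp add: rep)
    from frechet_derivative_at[OF this, symmetric] show ?thesis
      unfolding \<eta>'_def inner_sum_left by (simp add: inner_commute mult.commute)
  qed
  obtain s where s: "\<And>p. p \<in> S \<Longrightarrow> (s has_derivative (\<lambda>v. \<eta> p \<bullet> v)) (at p)"
  proof (rule closed_field_has_potential[OF S, of \<eta> \<eta>'])
    show "(\<eta> has_derivative \<eta>' p) (at p)" if "p \<in> S" for p
      unfolding \<eta>_def \<eta>'_def by (intro has_derivative_sum has_derivative_scaleR_left d[OF that])
    show "continuous_on S (\<lambda>p. \<eta>' p v)" for v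
      unfolding \<eta>'_def by (intro continuous_intros C_infinity_onD(3)[OF C_infinity_onD(2)[OF smooth]])
    show "\<eta>' p v \<bullet> w = \<eta>' p w \<bullet> v" if "p \<in> S" for p v w
      using closed[OF that] by (simp add: \<eta>'_inner[OF that])
  qed blast
  have s': "(s has_derivative \<omega> p) (at p)" if "p \<in> S" for p
    using s[OF that] by (simp add: \<eta>_inner[OF that])
  show thesis
    by (rule that[OF C_infinity_onI[OF S(1) s' smooth] s'])
qed

text \<open>On the circle the differentials of \<open>f1\<close> and \<open>f2\<close> are both
  multiples of the angle form \<omega>, so their wedge product vanishes and \<omega> is closed.
  Rotating \<open>(f1, f2)\<close> back by a potential gives a vector with zero derivative,
  constantly (1, 0).\<close>

lemma unit_circle_lift:
  fixes f1 f2 :: "'a::euclidean_space \<Rightarrow> real"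
  assumes S: "open S" "convex S" "0 \<in> S"
    and f: "C_infinity_on f1 S" "C_infinity_on f2 S"
    and unit: "\<And>p. p \<in> S \<Longrightarrow> (f1 p)\<^sup>2 + (f2 p)\<^sup>2 = 1"
  obtains s where "C_infinity_on s S" "\<And>p. p \<in> S \<Longrightarrow> f1 p = cos (s p)" "\<And>p. p \<in> S \<Longrightarrow> f2 p = sin (s p)"
proof -
  let ?d = "\<lambda>f v x. frechet_derivative f (at x) v"
  define \<omega> where "\<omega> p v = f1 p * ?d f2 v p - f2 p * ?d f1 v p" for p v
  note d = C_infinity_onD(1)[OF f(1)] C_infinity_onD(1)[OF f(2)]
  note dd = C_infinity_onD(1)[OF C_infinity_onD(2)[OF f(1)]] C_infinity_onD(1)[OF C_infinity_onD(2)[OF f(2)]]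
  have orth: "f1 p * ?d f1 v p + f2 p * ?d f2 v p = 0" if "p \<in> S" for p v
  proof -
    have "((\<lambda>p. f1 p * f1 p + f2 p * f2 p) has_derivative
        (\<lambda>v. f1 p * ?d f1 v p + ?d f1 v p * f1 p + (f2 p * ?d f2 v p + ?d f2 v p * f2 p))) (at p)"
      by (intro has_derivative_add has_derivative_mult d that)
    moreover have "((\<lambda>p. f1 p * f1 p + f2 p * f2 p) has_derivative (\<lambda>v. 0)) (at p)"
      by (rule has_derivative_transform_within_open[OF has_derivative_const S(1) that, of 1])
        (use unit in \<open>simp add: power2_eq_square\<close>)
    ultimately have "(\<lambda>v. f1 p * ?d f1 v p + ?d f1 v p * f1 p + (f2 p * ?d f2 v p + ?d f2 v p * f2 p)) = (\<lambda>v. 0)"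
      by (rule has_derivative_unique)
    from fun_cong[OF this, of v] show ?thesis by simp
  qed
  have \<omega>: "?d f1 v p = - f2 p * \<omega> p v" "?d f2 v p = f1 p * \<omega> p v" if "p \<in> S" for p v
    using orth[OF that, of v] unit[OF that] unfolding \<omega>_def by algebra+
  obtain s where s: "C_infinity_on s S" "\<And>p. p \<in> S \<Longrightarrow> (s has_derivative \<omega> p) (at p)"
  proof (rule closed_form_has_potential[OF S, of \<omega>])
    show "linear (\<omega> p)" if "p \<in> S" for p
      using has_derivative_linear[OF d(1)[OF that]] has_derivative_linear[OF d(2)[OF that]]
      unfolding \<omega>_def by (auto simp: linear_iff algebra_simps)
    show "C_infinity_on (\<lambda>p. \<omega> p v) S" for v
      unfolding \<omega>_def by (intro smooth_intros S f C_infinity_onD(2))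
    show "?d (\<lambda>p. \<omega> p v) w p = ?d (\<lambda>p. \<omega> p w) v p" if "p \<in> S" for p v w
    proof -
      have "((\<lambda>p. \<omega> p v) has_derivative (\<lambda>w. f1 p * ?d (?d f2 v) w p + ?d f1 w p * ?d f2 v p
          - (f2 p * ?d (?d f1 v) w p + ?d f2 w p * ?d f1 v p))) (at p)" for v
        unfolding \<omega>_def by (intro has_derivative_diff has_derivative_mult d dd that)
      from this[THEN frechet_derivative_at, symmetric] show ?thesis
        by (simp add: \<omega>[OF that] symmetric_second_derivative[OF f(1) S(1) that, of v w]
            symmetric_second_derivative[OF f(2) S(1) that, of v w])
    qed
  qed blast
  obtain t where t: "f1 0 = cos t" "f2 0 = sin t"
    using sincos_total_2pi[OF unit[OF S(3)]] by metis
  \<comment> \<open>The potential is shifted to take the value \<open>t\<close> at 0, an angle of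
    \<open>(f1 0, f2 0)\<close>.\<close>
  define r where "r p = s p + (t - s 0)" for p
  have r: "(r has_derivative \<omega> p) (at p)" if "p \<in> S" for p
    unfolding r_def using has_derivative_add[OF s(2)[OF that] has_derivative_const] by simp
  have sc: "((\<lambda>p. sin (r p)) has_derivative (\<lambda>v. \<omega> p v * cos (r p))) (at p)"
    "((\<lambda>p. cos (r p)) has_derivative (\<lambda>v. \<omega> p v * - sin (r p))) (at p)" if "p \<in> S" for p
    using DERIV_compose_FDERIV[OF DERIV_sin r[OF that]] DERIV_compose_FDERIV[OF DERIV_cos r[OF that]] by auto
  have "((\<lambda>p. f1 p * cos (r p) + f2 p * sin (r p)) has_derivative (\<lambda>v. 0)) (at p)" if "p \<in> S" for p
  proof -
    have "((\<lambda>p. f1 p * cos (r p) + f2 p * sin (r p)) has_derivative (\<lambda>v. f1 p * (\<omega> p v * - sin (r p)) + ?d f1 v p * cos (r p) + (f2 p * (\<omega> p v * cos (r p)) + ?d f2 v p * sin (r p)))) (at p)"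
      by (intro has_derivative_add has_derivative_mult d sc that)
    then show ?thesis by (simp add: \<omega>[OF that])
  qed
  from has_derivative_zero_unique[OF S(2) has_derivative_at_withinI[OF this] _ S(3)]
  have 1: "f1 p * cos (r p) + f2 p * sin (r p) = 1" if "p \<in> S" for p
    using that t by (simp add: r_def power2_eq_square[symmetric])
  have "((\<lambda>p. f2 p * cos (r p) - f1 p * sin (r p)) has_derivative (\<lambda>v. 0)) (at p)" if "p \<in> S" for p
  proof -
    have "((\<lambda>p. f2 p * cos (r p) - f1 p * sin (r p)) has_derivative (\<lambda>v. f2 p * (\<omega> p v * - sin (r p)) + ?d f2 v p * cos (r p) - (f1 p * (\<omega> p v * cos (r p)) + ?d f1 v p * sin (r p)))) (at p)"
      by (intro has_derivative_diff has_derivative_mult d sc that)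
    then show ?thesis by (simp add: \<omega>[OF that])
  qed
  from has_derivative_zero_unique[OF S(2) has_derivative_at_withinI[OF this] _ S(3)]
  have 2: "f2 p * cos (r p) - f1 p * sin (r p) = 0" if "p \<in> S" for p
    using that t by (simp add: r_def)
  show thesis
  proof
    show "C_infinity_on r S" unfolding r_def by (intro smooth_intros S s)
    show "f1 p = cos (r p)" "f2 p = sin (r p)" if "p \<in> S" for p
      using 1[OF that] 2[OF that] sin_cos_squared_add[of "r p"] by algebra+
  qed
qed

section \<open>Global sections of expanding local homeomorphisms\<close>

text \<open>Otherwise there are pairs of distinct points with equal images, ever closer to
  \<open>K\<close>. Along a subsequence they converge to points of \<open>K\<close> with equal
  images, hence to a single point, and this contradicts local injectivity there.\<close>

lemma injective_on_neighbourhood_of_compact: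
  fixes F :: "'a::euclidean_space \<Rightarrow> 'b::t2_space"
  assumes K: "compact K" "K \<subseteq> D" and D: "open D" and F: "continuous_on D F" "inj_on F K"
    and loc: "\<And>p. p \<in> D \<Longrightarrow> \<exists>r>0. inj_on F (ball p r)"
  obtains N where "open N" "K \<subseteq> N" "N \<subseteq> D" "inj_on F N"
proof -
  obtain e where e: "e > 0" "(\<Union>x\<in>K. cball x e) \<subseteq> D"
    using compact_subset_open_imp_cball_epsilon_subset[OF K(1) D K(2)] by blast
  \<comment> \<open>Neighbourhoods shrinking to \<open>K\<close>; since
    \<open>e / Suc n \<le> e\<close>, all lie in \<open>D\<close>.\<close>
  define N where "N n = (\<Union>x\<in>K. ball x (e / Suc n))" for n
  have N: "open (N n)" "K \<subseteq> N n" for n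
    using e(1) by (force simp: N_def)+
  have ND: "N n \<subseteq> D" for n
  proof -
    have "e / Suc n \<le> e" using e(1) by (simp add: field_simps)
    then show ?thesis using e(2) by (fastforce simp: N_def)
  qed
  have "\<exists>n. inj_on F (N n)"
  proof (rule ccontr)
    assume "\<nexists>n. inj_on F (N n)"
    then have no_inj: "\<not> inj_on F (N n)" for n by blast
    have "\<exists>a b x y. x \<in> K \<and> y \<in> K \<and> dist x a < e / Suc n \<and> dist y b < e / Suc n \<and> a \<noteq> b \<and> F a = F b
        \<and> a \<in> D \<and> b \<in> D" for n
    proof -
      obtain a b where ab: "a \<in> N n" "b \<in> N n" "a \<noteq> b" "F a = F b"
        using no_inj[of n] unfolding inj_on_def by blast
      then obtain x y where "x \<in> K" "dist x a < e / Suc n" "y \<in> K" "dist y b < e / Suc n"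
        unfolding N_def by auto
      then show ?thesis using ab ND by blast
    qed
    then have "\<forall>n. \<exists>a b x y. x \<in> K \<and> y \<in> K \<and> dist x a < e / Suc n \<and> dist y b < e / Suc n \<and> a \<noteq> b \<and> F a = F b
        \<and> a \<in> D \<and> b \<in> D" by blast
    then obtain a b x y where ab: "\<And>n. x n \<in> K" "\<And>n. y n \<in> K" "\<And>n. dist (x n) (a n) < e / Suc n"
      "\<And>n. dist (y n) (b n) < e / Suc n" "\<And>n. a n \<noteq> b n" "\<And>n. F (a n) = F (b n)"
      "\<And>n. a n \<in> D" "\<And>n. b n \<in> D"
      unfolding choice_iff by blast
    obtain l r where l: "l \<in> K \<times> K" "strict_mono (r :: nat \<Rightarrow> nat)" "((\<lambda>n. (x n, y n)) \<circ> r) \<longlonglongrightarrow> l"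
      using compact_Times[OF K(1) K(1), unfolded compact_def, rule_format, of "\<lambda>n. (x n, y n)"] ab(1,2) by auto
    obtain p q where pq: "l = (p, q)" by fastforce
    have xy: "(\<lambda>n. x (r n)) \<longlonglongrightarrow> p" "(\<lambda>n. y (r n)) \<longlonglongrightarrow> q"
      using tendsto_fst[OF l(3)] tendsto_snd[OF l(3)] by (simp_all add: o_def pq)
    have zero: "(\<lambda>n. e / Suc (r n)) \<longlonglongrightarrow> 0"
      using LIMSEQ_subseq_LIMSEQ[OF LIMSEQ_Suc[OF lim_const_over_n[of e]] l(2)] by (simp add: o_def)
    have diff: "(\<lambda>n. x (r n) - a (r n)) \<longlonglongrightarrow> 0" "(\<lambda>n. y (r n) - b (r n)) \<longlonglongrightarrow> 0"
      using ab(3,4)[unfolded dist_norm]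
      by (auto intro!: Lim_null_comparison[OF _ zero] always_eventually less_imp_le simp del: of_nat_Suc)
    have lim: "(\<lambda>n. a (r n)) \<longlonglongrightarrow> p" "(\<lambda>n. b (r n)) \<longlonglongrightarrow> q"
      using tendsto_diff[OF xy(1) diff(1)] tendsto_diff[OF xy(2) diff(2)] by simp_all
    have pqK: "p \<in> K" "q \<in> K" using l(1) pq by auto
    then have "isCont F p" "isCont F q"
      using F(1) D K(2) by (auto simp: continuous_on_eq_continuous_at)
    then have "(\<lambda>n. F (a (r n))) \<longlonglongrightarrow> F p" "(\<lambda>n. F (b (r n))) \<longlonglongrightarrow> F q"
      using lim isCont_tendsto_compose by blast+
    then have "F p = F q" using ab(6) LIMSEQ_unique by auto
    then have "p = q" using F(2) pqK by (auto dest: inj_onD)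
    obtain d where d: "d > 0" "inj_on F (ball p d)" using loc pqK(1) K(2) by blast
    have near: "\<forall>\<^sub>F n in sequentially. dist (a (r n)) p < d" "\<forall>\<^sub>F n in sequentially. dist (b (r n)) p < d"
      using lim \<open>p = q\<close> d(1) tendstoD by blast+
    obtain n where "dist (a (r n)) p < d" "dist (b (r n)) p < d"
      using eventually_happens'[OF sequentially_bot eventually_conj[OF near]] by blast
    then show False
      using d(2) ab(5,6)[of "r n"] by (auto simp: inj_on_def dist_commute)
  qed
  then obtain n where "inj_on F (N n)" ..
  then show thesis by (rule that[OF N ND])
qed

text \<open>\<open>G\<close> is the inverse of the derivative of \<open>F\<close>. The exhaustion function \<open>f\<close> expresses completeness: it
  grows at most linearly along lifts, so the lift of a bounded set stays in a compact set.\<close>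

locale expanding_local_homeo =
  fixes D :: "'a::euclidean_space set" and F :: "'a \<Rightarrow> 'a" and F' G :: "'a \<Rightarrow> 'a \<Rightarrow> 'a"
    and f :: "'a \<Rightarrow> real" and f' :: "'a \<Rightarrow> 'a \<Rightarrow> real" and B C :: real and p0 :: 'a
  assumes D: "open D" "p0 \<in> D"
    and F: "\<And>p. p \<in> D \<Longrightarrow> (F has_derivative F' p) (at p)"
    and loc: "\<And>p. p \<in> D \<Longrightarrow> \<exists>r>0. inj_on F (ball p r)"
    and G: "\<And>p. p \<in> D \<Longrightarrow> linear (G p)" "\<And>p v. p \<in> D \<Longrightarrow> G p (F' p v) = v"
      "\<And>p v. p \<in> D \<Longrightarrow> norm (G p v) \<le> B * norm v"
    and f: "\<And>p. p \<in> D \<Longrightarrow> (f has_derivative f' p) (at p)"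
      "\<And>p v. p \<in> D \<Longrightarrow> \<bar>f' p (G p v)\<bar> \<le> C * norm v"
      "\<And>M. compact {p \<in> D. f p \<le> M}"
    and F0: "F p0 = 0" and BC: "0 \<le> B" "0 \<le> C"
begin

text \<open>A section of \<open>F\<close> over \<open>A\<close>. Fixing its value at 0 makes
  sections over concentric balls agree.\<close>

definition lift_on :: "('a \<Rightarrow> 'a) \<Rightarrow> 'a set \<Rightarrow> bool" where
  "lift_on x A \<longleftrightarrow> continuous_on A x \<and> x ` A \<subseteq> D \<and> (\<forall>z\<in>A. F (x z) = z) \<and> x 0 = p0"

lemma contF: "continuous_on D F"
  using F has_derivative_continuous by (blast intro: continuous_at_imp_continuous_on)

lemma lift_on_subset: "lift_on x A \<Longrightarrow> A' \<subseteq> A \<Longrightarrow> lift_on x A'"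
  unfolding lift_on_def using continuous_on_subset by blast

text \<open>The agreement set is open by local injectivity of \<open>F\<close> and closed by
  continuity; in other words, the truth value of \<open>x z = y z\<close> is locally constant on a
  connected set.\<close>

lemma lift_on_unique:
  assumes "lift_on x A" "lift_on y A" "connected A" "0 \<in> A" "z \<in> A"
  shows "x z = y z"
proof -
  have "\<forall>\<^sub>F w in at z within A. (x z = y z) = (x w = y w)" if z: "z \<in> A" for z
  proof -
    have lim: "(x \<longlongrightarrow> x z) (at z within A)" "(y \<longlongrightarrow> y z) (at z within A)"
      using assms(1,2) z by (auto simp: lift_on_def continuous_on_def)
    show ?thesis
    proof (cases "x z = y z")
      case True
      have "x z \<in> D" using assms(1) z by (auto simp: lift_on_def)
      then obtain r where r: "r > 0" "inj_on F (ball (x z) r)" using loc by blast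
      have "\<forall>\<^sub>F w in at z within A. w \<in> A \<and> dist (x w) (x z) < r \<and> dist (y w) (x z) < r"
        using tendstoD[OF lim(1) r(1)] tendstoD[OF lim(2) r(1)] True
        by (simp add: eventually_conj_iff eventually_at_filter)
      then show ?thesis
      proof eventually_elim
        case (elim w)
        have "F (x w) = F (y w)" using assms(1,2) elim by (simp add: lift_on_def)
        then have "x w = y w" using r(2) elim by (auto simp: inj_on_def dist_commute)
        then show ?case using True by simp
      qed
    next
      case False
      have "((\<lambda>w. x w - y w) \<longlongrightarrow> x z - y z) (at z within A)" by (intro tendsto_diff lim)
      then have "\<forall>\<^sub>F w in at z within A. x w - y w \<noteq> 0"
        using False by (intro tendsto_imp_eventually_ne) auto
      then show ?thesis by eventually_elim (use False in auto)
    qed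
  qed
  from connected_local_const[OF assms(3,4,5), of "\<lambda>z. x z = y z"] this
  show ?thesis using assms(1,2) by (auto simp: lift_on_def)
qed

text \<open>A continuous right inverse is differentiable where the derivative of \<open>F\<close> is
  inverted by \<open>G\<close>, as in the inverse function theorem.\<close>

lemma lift_has_derivative:
  assumes "lift_on x A" "open A" "z \<in> A"
  shows "(x has_derivative G (x z)) (at z)"
proof -
  have x: "x z \<in> D" "continuous (at z) x" "\<And>w. w \<in> A \<Longrightarrow> F (x w) = w"
    using assms by (auto simp: lift_on_def continuous_on_eq_continuous_at)
  show ?thesis
    by (rule has_derivative_inverse_basic[OF F[OF x(1)] _ _ x(2) assms(2,3) x(3)])
      (use G[OF x(1)] linear_conv_bounded_linear in \<open>auto simp: fun_eq_iff\<close>)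
qed

lemma lift_bounded:
  assumes "lift_on x (ball 0 r)" "z \<in> ball 0 r"
  shows "f (x z) \<le> f p0 + C * r"
proof -
  have "norm (f (x z) - f (x 0)) \<le> C * norm (z - 0)"
  proof (rule differentiable_bound[of "ball 0 r" "\<lambda>z. f (x z)" "\<lambda>z v. f' (x z) (G (x z) v)"])
    fix z :: 'a assume z: "z \<in> ball 0 r"
    have xz: "x z \<in> D" using assms(1) z by (auto simp: lift_on_def)
    show "((\<lambda>z. f (x z)) has_derivative (\<lambda>v. f' (x z) (G (x z) v))) (at z within ball 0 r)"
      by (rule has_derivative_at_withinI[OF has_derivative_compose[OF lift_has_derivative[OF assms(1) open_ball z] f(1)[OF xz]]])
    show "onorm (\<lambda>v. f' (x z) (G (x z) v)) \<le> C"
      using f(2)[OF xz] BC by (intro onorm_bound) auto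
  qed (use assms(2) in \<open>auto intro: le_less_trans[OF norm_ge_zero]\<close>)
  also have "\<dots> \<le> C * r" using assms(2) BC by (intro mult_left_mono) auto
  finally show ?thesis using assms(1,2) by (simp add: lift_on_def)
qed

text \<open>The bound on \<open>G\<close> makes the section Lipschitz, so it extends continuously to
  the closed ball. By \<open>lift_bounded\<close> its image stays in a compact sublevel set of
  \<open>f\<close>, so the limits cannot leave \<open>D\<close>.\<close>

lemma lift_closure:
  assumes x: "lift_on x (ball 0 r)" and "r > 0"
  shows "\<exists>y. lift_on y (cball 0 r)"
proof -
  have "B-lipschitz_on (ball 0 r) x"
  proof (rule bounded_derivative_imp_lipschitz[where f' = "\<lambda>z. G (x z)"])
    fix z :: 'a assume z: "z \<in> ball 0 r"
    show "(x has_derivative G (x z)) (at z within ball 0 r)"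
      by (rule has_derivative_at_withinI[OF lift_has_derivative[OF x open_ball z]])
    have "x z \<in> D" using x z by (auto simp: lift_on_def)
    then show "onorm (G (x z)) \<le> B" using G(3) BC by (intro onorm_bound) auto
  qed (use BC in auto)
  then obtain y where y: "B-lipschitz_on (closure (ball 0 r)) y" "\<And>z. z \<in> ball 0 r \<Longrightarrow> y z = x z"
    using lipschitz_extend_closure by meson
  have cont: "continuous_on (closure (ball 0 r)) y"
    using y(1) by (rule lipschitz_on_continuous_on)
  have "y ` closure (ball 0 r) \<subseteq> {p \<in> D. f p \<le> f p0 + C * r}"
    using x y(2) lift_bounded[OF x]
    by (intro image_closure_subset[OF cont] compact_imp_closed f(3)) (auto simp: lift_on_def)
  then have yD: "y ` closure (ball 0 r) \<subseteq> D" by blast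
  have "F (y z) - z = 0" if "z \<in> closure (ball 0 r)" for z :: 'a
  proof (rule continuous_constant_on_closure[OF _ _ that])
    show "continuous_on (closure (ball 0 r)) (\<lambda>z. F (y z) - z)"
      by (intro continuous_intros continuous_on_compose2[OF contF cont yD])
    show "F (y z) - z = 0" if "z \<in> ball 0 r" for z :: 'a
      using that x y(2) by (simp add: lift_on_def)
  qed
  moreover have "y 0 = p0" using y(2)[of 0] x \<open>r > 0\<close> by (simp add: lift_on_def)
  ultimately have "lift_on y (cball 0 r)"
    using cont yD \<open>r > 0\<close> by (auto simp: lift_on_def)
  then show ?thesis by blast
qed

text \<open>\<open>F\<close> is injective on the image of a section, hence on a neighbourhood
  \<open>N\<close> of this compact image. By invariance of domain \<open>F\<close> maps
  \<open>N\<close> onto an open set, which contains a larger ball, and the inverse of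
  \<open>F\<close> on \<open>N\<close> is the new section.\<close>

lemma lift_extend:
  assumes x: "lift_on x (cball 0 r)" and "r \<ge> 0"
  shows "\<exists>r'>r. \<exists>y. lift_on y (cball 0 r')"
proof -
  have K: "compact (x ` cball 0 r)" "x ` cball 0 r \<subseteq> D" "inj_on F (x ` cball 0 r)"
    using x by (auto simp: lift_on_def inj_on_def intro: compact_continuous_image)
  obtain N where N: "open N" "x ` cball 0 r \<subseteq> N" "N \<subseteq> D" "inj_on F N"
    using injective_on_neighbourhood_of_compact[OF K(1,2) D(1) contF K(3) loc] by blast
  have contN: "continuous_on N F" using contF N(3) continuous_on_subset by blast
  have "open (F ` N)" using invariance_of_domain[OF contN N(1,4)] .
  moreover have "cball 0 r \<subseteq> F ` N"
  proof
    fix z :: 'a assume "z \<in> cball 0 r"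
    then have "x z \<in> N" "F (x z) = z" using N(2) x by (auto simp: lift_on_def)
    then show "z \<in> F ` N" by force
  qed
  ultimately obtain e where e: "e > 0" "(\<Union>z\<in>cball 0 r. cball z e) \<subseteq> F ` N"
    using compact_subset_open_imp_cball_epsilon_subset[OF compact_cball] by metis
  have sub: "cball 0 (r + e) \<subseteq> F ` N"
  proof
    fix z :: 'a assume z: "z \<in> cball 0 (r + e)"
    show "z \<in> F ` N"
    proof (cases "norm z \<le> r")
      case True
      then show ?thesis using \<open>cball 0 r \<subseteq> F ` N\<close> by auto
    next
      case False
      then have nz: "norm z > 0" using \<open>r \<ge> 0\<close> by linarith
      \<comment> \<open>The radial projection of \<open>z\<close> to the sphere of radius
        \<open>r\<close> is a point of the old ball within \<open>e\<close> of
        \<open>z\<close>.\<close>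
      have "(r / norm z) *\<^sub>R z - z = ((r - norm z) / norm z) *\<^sub>R z"
        using nz by (simp add: algebra_simps diff_divide_distrib)
      then have "dist ((r / norm z) *\<^sub>R z) z = \<bar>r - norm z\<bar>"
        using nz by (simp add: dist_norm)
      then have "z \<in> cball ((r / norm z) *\<^sub>R z) e" "(r / norm z) *\<^sub>R z \<in> cball 0 r"
        using z False nz \<open>r \<ge> 0\<close> by auto
      then show ?thesis using e(2) by blast
    qed
  qed
  let ?y = "inv_into N F"
  have "continuous_on (F ` N) ?y"
    using N(4) by (intro continuous_on_inverse_open[OF N(1) contN]) auto
  moreover have "p0 \<in> N" using N(2) x \<open>r \<ge> 0\<close> by (auto simp: lift_on_def)
  then have "?y 0 = p0" using inv_into_f_f[OF N(4)] F0 by metis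
  ultimately have "lift_on ?y (F ` N)"
    using N(3) inv_into_into[of _ F N] by (auto simp: lift_on_def f_inv_into_f)
  then have "lift_on ?y (cball 0 (r + e))" using sub lift_on_subset by blast
  then show ?thesis using e(1) by (intro exI[of _ "r + e"]) auto
qed

text \<open>By uniqueness the value at \<open>z\<close> does not depend on the radius
  \<open>\<rho> z\<close> chosen for it.\<close>

lemma lifts_combine:
  assumes "\<And>r. r \<in> I \<Longrightarrow> \<exists>x. lift_on x (cball 0 r)"
  obtains x where "\<And>r. r \<in> I \<Longrightarrow> 0 \<le> r \<Longrightarrow> lift_on x (cball 0 r)"
proof -
  obtain X where X: "\<And>r. r \<in> I \<Longrightarrow> lift_on (X r) (cball 0 r)" using assms by metis
  define \<rho> where "\<rho> z = (SOME r. r \<in> I \<and> norm z \<le> r)" for z :: 'a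
  define x where "x z = X (\<rho> z) z" for z
  have eq: "x z = X r z" if "r \<in> I" "norm z \<le> r" for r and z :: 'a
  proof -
    have \<rho>: "\<rho> z \<in> I" "norm z \<le> \<rho> z"
      using someI[of "\<lambda>r. r \<in> I \<and> norm z \<le> r" r] that by (auto simp: \<rho>_def)
    have sub: "cball 0 (norm z) \<subseteq> cball 0 (\<rho> z)" "cball 0 (norm z) \<subseteq> cball 0 r"
      using \<rho> that by auto
    show ?thesis
      unfolding x_def
      by (rule lift_on_unique[OF lift_on_subset[OF X[OF \<rho>(1)] sub(1)] lift_on_subset[OF X[OF that(1)] sub(2)]])
        auto
  qed
  show thesis
  proof
    fix r assume r: "r \<in> I" "0 \<le> r"
    have "x z = X r z" if "z \<in> cball 0 r" for z using eq[OF r(1)] that by simp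
    moreover from this have "continuous_on (cball 0 r) x \<longleftrightarrow> continuous_on (cball 0 r) (X r)"
      by (rule continuous_on_cong[OF refl])
    ultimately show "lift_on x (cball 0 r)"
      using X[OF r(1)] r(2) by (auto simp: lift_on_def)
  qed
qed

text \<open>The strict inequality puts \<open>z\<close> in the interior of the ball, where
  continuity on the ball is continuity at \<open>z\<close>.\<close>

lemma lift_on_openI:
  assumes "open A" "0 \<in> A" "\<And>z. z \<in> A \<Longrightarrow> \<exists>r. norm z < r \<and> lift_on x (cball 0 r)"
  shows "lift_on x A"
proof -
  have "isCont x z \<and> x z \<in> D \<and> F (x z) = z" if z: "z \<in> A" for z
  proof -
    obtain r where r: "norm z < r" "lift_on x (cball 0 r)" using assms(3)[OF z] by blast
    then have "lift_on x (ball 0 r)" using lift_on_subset ball_subset_cball by blast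
    then show ?thesis using r(1) by (auto simp: lift_on_def continuous_on_eq_continuous_at)
  qed
  moreover have "x 0 = p0" using assms(3)[OF assms(2)] by (auto simp: lift_on_def)
  ultimately show ?thesis
    by (auto simp: lift_on_def intro: continuous_at_imp_continuous_on)
qed

text \<open>If the radii were bounded, \<open>lift_extend\<close> would keep them from attaining
  their supremum \<open>T\<close>. But the sections below \<open>T\<close> glue over the open ball,
  and \<open>lift_closure\<close> then puts \<open>T\<close> among the radii.\<close>

lemma lift_exists:
  assumes "r \<ge> 0"
  shows "\<exists>x. lift_on x (cball 0 r)"
proof (rule ccontr)
  assume no: "\<nexists>x. lift_on x (cball 0 r)"
  define R where "R = {r. 0 \<le> r \<and> (\<exists>x. lift_on x (cball 0 r))}"
  have down: "s \<in> R" if "t \<in> R" "0 \<le> s" "s \<le> t" for s t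
    using that lift_on_subset[of _ "cball 0 t" "cball 0 s"] by (force simp: R_def)
  have "lift_on (\<lambda>_. p0) (cball 0 0)" using D F0 by (auto simp: lift_on_def)
  then have "0 \<in> R" by (auto simp: R_def)
  have bdd: "t < r" if "t \<in> R" for t using down[OF that assms] no by (force simp: R_def)
  then have bd: "bdd_above R" by (intro bdd_aboveI[of _ r]) (auto intro: less_imp_le)
  define T where "T = Sup R"
  have up: "t < T" if t: "t \<in> R" for t
  proof -
    obtain x where "0 \<le> t" "lift_on x (cball 0 t)" using t by (auto simp: R_def)
    from lift_extend[OF this(2,1)] obtain t' where "t' > t" "t' \<in> R"
      using \<open>0 \<le> t\<close> by (fastforce simp: R_def)
    then show ?thesis using cSup_upper[OF _ bd, of t'] by (simp add: T_def)
  qed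
  have in_R: "t \<in> R" if t: "0 \<le> t" "t < T" for t
  proof -
    obtain s where "s \<in> R" "t < s" using less_cSupD[of R t] \<open>0 \<in> R\<close> t by (auto simp: T_def)
    then show ?thesis using down t by simp
  qed
  obtain x where x: "\<And>t. t \<in> {0..<T} \<Longrightarrow> 0 \<le> t \<Longrightarrow> lift_on x (cball 0 t)"
    using lifts_combine[of "{0..<T}"] in_R by (auto simp: R_def)
  have "lift_on x (ball 0 T)"
  proof (rule lift_on_openI)
    fix z :: 'a assume "z \<in> ball 0 T"
    then have z: "norm z < T" by simp
    then have "norm z < (norm z + T) / 2" "(norm z + T) / 2 < T" by auto
    then show "\<exists>r. norm z < r \<and> lift_on x (cball 0 r)"
      using x[of "(norm z + T) / 2"] norm_ge_zero[of z] by (smt (verit) atLeastLessThan_iff)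
  qed (use up[OF \<open>0 \<in> R\<close>] in auto)
  then have "T \<in> R" using lift_closure[of x T] up[OF \<open>0 \<in> R\<close>] by (auto simp: R_def)
  then show False using up by blast
qed

lemma global_section:
  obtains x where "\<And>z. x z \<in> D" "\<And>z. F (x z) = z" "\<And>z. (x has_derivative G (x z)) (at z)"
proof -
  obtain x where x: "\<And>r. 0 \<le> r \<Longrightarrow> lift_on x (cball 0 r)"
    using lifts_combine[of "{0..}"] lift_exists by auto
  have "\<exists>r. norm z < r \<and> lift_on x (cball 0 r)" for z :: 'a
    using x[of "norm z + 1"] norm_ge_zero[of z] by (intro exI[of _ "norm z + 1"]) linarith
  then have *: "lift_on x UNIV" by (intro lift_on_openI) auto
  then show thesis
    using lift_has_derivative[OF * open_UNIV UNIV_I] by (intro that[of x]) (auto simp: lift_on_def)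
qed

end

section \<open>The sine-Gordon equation\<close>

lemma sin_ge_min_endpoints:
  fixes t :: real
  assumes "0 \<le> a" "0 \<le> b" "a \<le> t" "t \<le> pi - b"
  shows "min (sin a) (sin b) \<le> sin t"
proof (cases "t \<le> pi / 2")
  case True
  then have "sin a \<le> sin t" using assms by (intro sin_monotone_2pi_le) auto
  then show ?thesis by simp
next
  case False
  then have "sin b \<le> sin (pi - t)" using assms by (intro sin_monotone_2pi_le) auto
  then show ?thesis by simp
qed

text \<open>Here \<open>P\<close> is the \<open>u\<close>-derivative of \<Theta>, and it increases
  in \<open>v\<close>. So on three intervals of length \<open>a\<close> on which \<open>P\<close> is
  positive at \<open>v0\<close>, the increments of \<Theta> do not shrink as \<open>v\<close> grows.
  The outer two, \<open>e1\<close> and \<open>e2\<close>, confine \<Theta> to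
  \<open>[e1, pi - e2]\<close> over the middle one, which bounds \<open>sin \<Theta>\<close> below
  by \<open>s\<close>. Then \<open>P\<close> grows at rate \<open>s\<close> there, and finally
  \<Theta> rises by pi across the middle interval.\<close>

lemma no_sine_Gordon_solution_pos:
  fixes \<Theta> P :: "real \<Rightarrow> real \<Rightarrow> real"
  assumes range: "\<And>u v. 0 < \<Theta> u v" "\<And>u v. \<Theta> u v < pi"
    and \<Theta>u: "\<And>u v. ((\<lambda>u. \<Theta> u v) has_real_derivative P u v) (at u)"
    and Pv: "\<And>u v. ((\<lambda>v. P u v) has_real_derivative sin (\<Theta> u v)) (at v)"
    and cont: "isCont (\<lambda>u. P u v0) u0" and pos: "P u0 v0 > 0"
  shows False
proof -
  have "\<forall>\<^sub>F u in at u0. P u v0 > 0"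
    using cont pos order_tendstoD(1)[of "\<lambda>u. P u v0"] by (auto simp: isCont_def)
  then obtain d where d: "d > 0" "\<And>u. u \<noteq> u0 \<Longrightarrow> dist u u0 < d \<Longrightarrow> P u v0 > 0"
    unfolding eventually_at by auto
  \<comment> \<open>All three intervals then lie in \<open>[u0, u0 + d / 2]\<close>, where
    \<open>P u v0\<close> is positive.\<close>
  define a where "a = d / 6"
  have a: "a > 0" using d by (simp add: a_def)
  have P0: "P u v0 > 0" if "u0 \<le> u" "u \<le> u0 + 3 * a" for u
    using d pos that by (cases "u = u0") (auto simp: a_def dist_real_def)
  have P_mono: "P u v0 \<le> P u v" if "v0 \<le> v" for u v
    using that by (rule DERIV_nonneg_imp_nondecreasing[where f = "P u"]) (use Pv sin_gt_zero[OF range] less_imp_le in blast)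
  have \<Theta>_mono: "\<Theta> s v \<le> \<Theta> t v" if "u0 \<le> s" "s \<le> t" "t \<le> u0 + 3 * a" "v0 \<le> v" for s t v
  proof (rule DERIV_nonneg_imp_nondecreasing[OF that(2)])
    fix u assume "s \<le> u" "u \<le> t"
    then have "0 \<le> P u v" using P0[of u] P_mono[OF that(4), of u] that by linarith
    then show "\<exists>y. ((\<lambda>u. \<Theta> u v) has_real_derivative y) (at u) \<and> 0 \<le> y" using \<Theta>u by blast
  qed
  have incr: "\<Theta> t v0 - \<Theta> s v0 \<le> \<Theta> t v - \<Theta> s v" if "u0 \<le> s" "s \<le> t" "t \<le> u0 + 3 * a" "v0 \<le> v" for s t v
  proof -
    have "\<Theta> s v - \<Theta> s v0 \<le> \<Theta> t v - \<Theta> t v0"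
    proof (rule DERIV_nonneg_imp_nondecreasing[OF that(2)])
      fix u
      show "\<exists>y. ((\<lambda>u. \<Theta> u v - \<Theta> u v0) has_real_derivative y) (at u) \<and> 0 \<le> y"
        using DERIV_diff[OF \<Theta>u[of v u] \<Theta>u[of v0 u]] P_mono[OF that(4), of u] diff_ge_0_iff_ge by blast
    qed
    then show ?thesis by linarith
  qed
  have strict: "\<Theta> s v0 < \<Theta> t v0" if "u0 \<le> s" "s < t" "t \<le> u0 + 3 * a" for s t
  proof (rule DERIV_pos_imp_increasing[OF that(2)])
    fix u assume "s \<le> u" "u \<le> t"
    then show "\<exists>y. ((\<lambda>u. \<Theta> u v0) has_real_derivative y) (at u) \<and> 0 < y"
      using \<Theta>u P0[of u] that by (meson order_trans)
  qed
  define e1 where "e1 = \<Theta> (u0 + a) v0 - \<Theta> u0 v0"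
  define e2 where "e2 = \<Theta> (u0 + 3 * a) v0 - \<Theta> (u0 + 2 * a) v0"
  have e: "0 < e1" "e1 < pi" "0 < e2" "e2 < pi"
    using strict[of u0 "u0 + a"] strict[of "u0 + 2 * a" "u0 + 3 * a"] a
      range[of u0 v0] range[of "u0 + a" v0] range[of "u0 + 2 * a" v0] range[of "u0 + 3 * a" v0]
    by (simp_all add: e1_def e2_def)
  define s where "s = min (sin e1) (sin e2)"
  have s: "s > 0" using e by (simp add: s_def sin_gt_zero)
  have sin_ge: "s \<le> sin (\<Theta> u v)" if "u0 + a \<le> u" "u \<le> u0 + 2 * a" "v0 \<le> v" for u v
  proof -
    have "e1 \<le> \<Theta> (u0 + a) v"
      using incr[of u0 "u0 + a" v] range(1)[of u0 v] a that by (simp add: e1_def)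
    moreover have "\<Theta> (u0 + 2 * a) v \<le> pi - e2"
      using incr[of "u0 + 2 * a" "u0 + 3 * a" v] range(2)[of "u0 + 3 * a" v] a that by (simp add: e2_def)
    moreover have "\<Theta> (u0 + a) v \<le> \<Theta> u v" "\<Theta> u v \<le> \<Theta> (u0 + 2 * a) v"
      using \<Theta>_mono[of "u0 + a" u v] \<Theta>_mono[of u "u0 + 2 * a" v] a that by simp_all
    ultimately show ?thesis
      unfolding s_def using e by (intro sin_ge_min_endpoints) linarith+
  qed
  have P_ge: "s * (v - v0) \<le> P u v" if "u0 + a \<le> u" "u \<le> u0 + 2 * a" "v0 \<le> v" for u v
  proof -
    have "P u v0 - s * v0 \<le> P u v - s * v"
    proof (rule DERIV_nonneg_imp_nondecreasing[OF that(3)])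
      fix w assume "v0 \<le> w"
      moreover have "((\<lambda>v. P u v - s * v) has_real_derivative sin (\<Theta> u w) - s) (at w)"
        using DERIV_diff[OF Pv[of u w] DERIV_cmult[OF DERIV_ident, of s]] by simp
      ultimately show "\<exists>y. ((\<lambda>v. P u v - s * v) has_real_derivative y) (at w) \<and> 0 \<le> y"
        using sin_ge[OF that(1,2)] diff_ge_0_iff_ge by blast
    qed
    moreover have "0 < P u v0" using that a by (intro P0) auto
    ultimately show ?thesis by (simp add: algebra_simps)
  qed
  \<comment> \<open>Chosen so that \<open>a * s * (v - v0) = pi\<close>.\<close>
  define v where "v = v0 + pi / (a * s)"
  have v: "v0 \<le> v" using a s by (simp add: v_def)
  have "\<Theta> (u0 + a) v - s * (v - v0) * (u0 + a) \<le> \<Theta> (u0 + 2 * a) v - s * (v - v0) * (u0 + 2 * a)"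
  proof (rule DERIV_nonneg_imp_nondecreasing[where f = "\<lambda>u. \<Theta> u v - s * (v - v0) * u"])
    fix u assume "u0 + a \<le> u" "u \<le> u0 + 2 * a"
    moreover have "((\<lambda>u. \<Theta> u v - s * (v - v0) * u) has_real_derivative P u v - s * (v - v0)) (at u)"
      using DERIV_diff[OF \<Theta>u[of v u] DERIV_cmult[OF DERIV_ident, of "s * (v - v0)"]] by simp
    ultimately show "\<exists>y. ((\<lambda>u. \<Theta> u v - s * (v - v0) * u) has_real_derivative y) (at u) \<and> 0 \<le> y"
      using P_ge[OF _ _ v] diff_ge_0_iff_ge by blast
  qed (use a in simp)
  moreover have "s * (v - v0) * (u0 + 2 * a) = s * (v - v0) * (u0 + a) + pi"
    using a s by (simp add: v_def field_simps)
  ultimately show False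
    using range(1)[of "u0 + a" v] range(2)[of "u0 + 2 * a" v] by linarith
qed

text \<open>Strict growth of \<open>P 0\<close> forces a positive value at 1 or a negative one at 0.
  The reflection of both variables preserves the equation and changes the sign of
  \<open>P\<close>.\<close>

lemma no_sine_Gordon_solution:
  fixes \<Theta> P :: "real \<Rightarrow> real \<Rightarrow> real"
  assumes range: "\<And>u v. 0 < \<Theta> u v" "\<And>u v. \<Theta> u v < pi"
    and \<Theta>u: "\<And>u v. ((\<lambda>u. \<Theta> u v) has_real_derivative P u v) (at u)"
    and Pv: "\<And>u v. ((\<lambda>v. P u v) has_real_derivative sin (\<Theta> u v)) (at v)"
    and cont: "\<And>u v. isCont (\<lambda>u. P u v) u"
  shows False
proof -
  have "P 0 0 < P 0 1"
    by (rule DERIV_pos_imp_increasing[where f = "P 0"]) (use Pv sin_gt_zero[OF range] in \<open>auto intro!: exI conjI\<close>)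
  then consider "P 0 1 > 0" | "P 0 0 < 0" by linarith
  then show False
  proof cases
    case 1
    then show False using no_sine_Gordon_solution_pos[OF range \<Theta>u Pv cont] by blast
  next
    case 2
    have "((\<lambda>u. \<Theta> (- u) (- v)) has_real_derivative - P (- u) (- v)) (at u)" for u v
      using \<Theta>u[of "- v" "- u"] by (simp add: DERIV_mirror)
    moreover have "((\<lambda>v. - P (- u) (- v)) has_real_derivative sin (\<Theta> (- u) (- v))) (at v)" for u v
      using Pv[of "- u" "- v"] by (intro DERIV_minus[where D = "- sin (\<Theta> (- u) (- v))", simplified])
        (simp add: DERIV_mirror)
    moreover have "isCont (\<lambda>u. - P (- u) (- 0)) 0"
      using isCont_o2[of 0 uminus "\<lambda>u. P u 0"] cont[of 0 0] by (intro continuous_minus) simp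
    ultimately show False
      using 2 no_sine_Gordon_solution_pos[of "\<lambda>u v. \<Theta> (- u) (- v)" "\<lambda>u v. - P (- u) (- v)" 0 0] range by simp
  qed
qed

section \<open>The Gauss and Codazzi equations\<close>

lemma poincare_disk_eq_ball: "poincare_disk = ball 0 1"
proof -
  have "norm p < 1 \<longleftrightarrow> norm p ^ 2 < 1 ^ 2" for p :: "real^2"
    by (simp add: abs_square_less_1)
  then show ?thesis
    unfolding set_eq_iff by (simp add: poincare_disk_def power2_norm_eq_inner inner_vec_def sum_2 flip: power2_eq_square)
qed

lemma open_poincare_disk: "open poincare_disk"
  and convex_poincare_disk: "convex poincare_disk"
  and zero_in_poincare_disk: "0 \<in> poincare_disk"
  by (simp_all add: poincare_disk_eq_ball)

abbreviation smooth :: "(real^2 \<Rightarrow> 'b::real_normed_vector) \<Rightarrow> bool" where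
  "smooth f \<equiv> C_infinity_on f poincare_disk"

lemmas disk_smooth_intros = smooth_intros[OF open_poincare_disk]

definition partial :: "2 \<Rightarrow> (real^2 \<Rightarrow> 'b::real_normed_vector) \<Rightarrow> real^2 \<Rightarrow> 'b" where
  "partial i f p = frechet_derivative f (at p) (axis i 1)"

lemma smooth_partial: "smooth f \<Longrightarrow> smooth (partial i f)"
  unfolding partial_def[abs_def] by (rule C_infinity_onD(2))

lemma partial_eqI: "(f has_derivative D) (at p) \<Longrightarrow> partial i f p = D (axis i 1)"
  unfolding partial_def using frechet_derivative_at by metis

lemma vec2_eq: "v = v $ 1 *\<^sub>R axis 1 1 + v $ 2 *\<^sub>R axis 2 (1::real)" for v :: "real^2"
  by (simp add: vec_eq_iff forall_2 axis_def)

lemma has_derivative_partial: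
  assumes "smooth f" "p \<in> poincare_disk"
  shows "(f has_derivative (\<lambda>v. v $ 1 *\<^sub>R partial 1 f p + v $ 2 *\<^sub>R partial 2 f p)) (at p)"
proof -
  have D: "(f has_derivative frechet_derivative f (at p)) (at p)"
    by (rule C_infinity_onD(1)[OF assms])
  have "frechet_derivative f (at p) v = v $ 1 *\<^sub>R partial 1 f p + v $ 2 *\<^sub>R partial 2 f p" for v
    using arg_cong[OF vec2_eq[of v], of "frechet_derivative f (at p)"]
    by (simp add: partial_def linear_add[OF has_derivative_linear[OF D]] linear_cmul[OF has_derivative_linear[OF D]])
  then show ?thesis using D by (metis (no_types, lifting) ext)
qed

lemma partial_bilinear:
  assumes "bounded_bilinear prd" "smooth f" "smooth g" "p \<in> poincare_disk"
  shows "partial i (\<lambda>x. prd (f x) (g x)) p = prd (f p) (partial i g p) + prd (partial i f p) (g p)"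
  unfolding partial_def
  using bounded_bilinear.FDERIV[OF assms(1) C_infinity_onD(1)[OF assms(2,4)] C_infinity_onD(1)[OF assms(3,4)]]
  by (metis (no_types, lifting) frechet_derivative_at)

lemmas partial_mult = partial_bilinear[OF bounded_bilinear_mult]
  and partial_scaleR = partial_bilinear[OF bounded_bilinear_scaleR]
  and partial_inner = partial_bilinear[OF bounded_bilinear_inner]

lemma partial_cong:
  assumes "\<And>x. x \<in> poincare_disk \<Longrightarrow> f x = g x" "smooth f" "p \<in> poincare_disk"
  shows "partial i g p = partial i f p"
  unfolding partial_def[of i f]
  by (intro partial_eqI has_derivative_transform_within_open[OF C_infinity_onD(1)[OF assms(2,3)]
      open_poincare_disk assms(3,1)])

lemma partial_const: "partial i (\<lambda>x. c) p = 0"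
  by (rule partial_eqI[OF has_derivative_const])

lemma partial_commute:
  fixes f :: "real^2 \<Rightarrow> 'b::euclidean_space"
  assumes "smooth f" "p \<in> poincare_disk"
  shows "partial i (partial j f) p = partial j (partial i f) p"
  using symmetric_second_derivative[OF assms(1) open_poincare_disk assms(2)]
  by (simp add: partial_def[abs_def])

text \<open>The hyperbolic metric is \<open>conf\<^sup>2\<close> times the Euclidean one. Its connection form in the frame
  \<open>\<partial>\<^sub>1 / conf, \<partial>\<^sub>2 / conf\<close> is \<open>conf (- p\<^sub>2 dp\<^sub>1 + p\<^sub>1 dp\<^sub>2)\<close>, which is where the lower-order terms of all the
  equations below come from.\<close>

definition conf :: "real^2 \<Rightarrow> real" where
  "conf p = 2 / (1 - (p$1)\<^sup>2 - (p$2)\<^sup>2)"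

lemma conf_denominator: "p \<in> poincare_disk \<Longrightarrow> 1 - (p$1)\<^sup>2 - (p$2)\<^sup>2 > 0"
  by (simp add: poincare_disk_def)

lemma conf_pos: "p \<in> poincare_disk \<Longrightarrow> conf p > 0"
  unfolding conf_def using conf_denominator by simp

lemma conf_ge_2:
  assumes "p \<in> poincare_disk"
  shows "conf p \<ge> 2"
  unfolding conf_def using conf_denominator[OF assms] by (simp add: le_divide_eq)

lemma smooth_conf: "smooth conf"
  unfolding conf_def[abs_def]
  using conf_denominator by (intro disk_smooth_intros) fastforce

lemma smooth_coordinate: "smooth (\<lambda>p. p $ i)"
  by (intro disk_smooth_intros)

lemma partial_coordinate: "partial i (\<lambda>p. p $ j) p = (if i = j then 1 else 0)"
  using partial_eqI[OF bounded_linear_imp_has_derivative[OF bounded_linear_vec_nth]]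
  by (simp add: axis_def)

lemma partial_conf:
  assumes p: "p \<in> poincare_disk"
  shows "partial i conf p = (conf p)\<^sup>2 * p $ i"
proof -
  have "(conf has_derivative (\<lambda>v. (conf p)\<^sup>2 * (p $ 1 * v $ 1 + p $ 2 * v $ 2))) (at p)"
    unfolding conf_def[abs_def] using conf_denominator[OF p]
    by (auto intro!: derivative_eq_intros bounded_linear.has_derivative[OF bounded_linear_vec_nth]
        simp: field_simps power2_eq_square)
  from partial_eqI[OF this, of i] show ?thesis
    using exhaust_2[of i] by (auto simp: axis_def)
qed

text \<open>Curvature -1: the differential of the connection form, on the left, is the area form, on
  the right.\<close>

lemma conf_curvature:
  assumes p: "p \<in> poincare_disk"
  shows "partial 1 (\<lambda>x. conf x * x $ 1) p + partial 2 (\<lambda>x. conf x * x $ 2) p = (conf p)\<^sup>2"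
proof -
  have d: "partial k (\<lambda>x. conf x * x $ k) p = conf p + (conf p)\<^sup>2 * (p $ k)\<^sup>2" for k
    by (simp add: partial_mult[OF smooth_conf smooth_coordinate p] partial_coordinate partial_conf[OF p] power2_eq_square)
  have "conf p * (1 - (p $ 1)\<^sup>2 - (p $ 2)\<^sup>2) = 2"
    unfolding conf_def using less_imp_neq[OF conf_denominator[OF p], symmetric]
    by (rule nonzero_eq_divide_eq[THEN iffD1, OF _ refl])
  moreover have "2 * c + c\<^sup>2 * (x + y) - c\<^sup>2 = c * (2 - c * (1 - x - y))" for c x y :: real
    by (simp add: algebra_simps power2_eq_square)
  ultimately have "2 * conf p + (conf p)\<^sup>2 * ((p $ 1)\<^sup>2 + (p $ 2)\<^sup>2) = (conf p)\<^sup>2"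
    by (metis diff_self eq_iff_diff_eq_0 mult_zero_right)
  then show ?thesis by (simp only: d distrib_left)
qed

text \<open>The remainder \<open>u\<close> is orthogonal to \<open>e1\<close> and \<open>e2\<close>,
  so by Lagrange's identity its cross product with \<open>cross3 e1 e2\<close> vanishes; it is also
  orthogonal to that vector, hence zero.\<close>

lemma orthonormal_expansion:
  fixes e1 e2 v w :: "real^3"
  assumes "e1 \<bullet> e1 = 1" "e2 \<bullet> e2 = 1" "e1 \<bullet> e2 = 0"
  shows "v \<bullet> w = (v \<bullet> e1) * (w \<bullet> e1) + (v \<bullet> e2) * (w \<bullet> e2) + (v \<bullet> cross3 e1 e2) * (w \<bullet> cross3 e1 e2)"
proof -
  let ?e = "cross3 e1 e2"
  have e: "?e \<bullet> ?e = 1"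
    using norm_cross_dot[of e1 e2] assms by (simp add: power2_norm_eq_inner power_mult_distrib)
  define u where "u = v - (v \<bullet> e1) *\<^sub>R e1 - (v \<bullet> e2) *\<^sub>R e2 - (v \<bullet> ?e) *\<^sub>R ?e"
  have "u \<bullet> e1 = 0" "u \<bullet> e2 = 0" "u \<bullet> ?e = 0"
    unfolding u_def using assms e by (simp_all add: inner_diff_left dot_cross_self inner_commute[of e2 e1])
  then have "cross3 u ?e = 0 \<and> u \<bullet> ?e = 0" by (simp add: Lagrange)
  then have "u = 0" using e using norm_and_cross_eq_0[of u ?e] by (metis inner_commute inner_zero_left zero_neq_one)
  then have "v = (v \<bullet> e1) *\<^sub>R e1 + (v \<bullet> e2) *\<^sub>R e2 + (v \<bullet> ?e) *\<^sub>R ?e"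
    unfolding u_def by (simp add: algebra_simps)
  from arg_cong[OF this, of "\<lambda>v. v \<bullet> w", unfolded inner_add_left inner_scaleR_left]
  show ?thesis by (simp only: inner_commute[of w])
qed

text \<open>The second fundamental form is \<open>conf (a dp\<^sub>1\<^sup>2 + 2 b dp\<^sub>1 dp\<^sub>2 + c dp\<^sub>2\<^sup>2)\<close>.\<close>

lemma Gauss_Codazzi:
  fixes \<phi> :: "real^2 \<Rightarrow> real^3"
  assumes "smooth_isometric_immersion poincare_disk poincare_metric \<phi>"
  obtains a b c where "smooth a" "smooth b" "smooth c"
    "\<And>p. p \<in> poincare_disk \<Longrightarrow> a p * c p - (b p)\<^sup>2 = - (conf p)\<^sup>2"
    "\<And>p. p \<in> poincare_disk \<Longrightarrow>
      partial 1 b p - partial 2 a p = - conf p * p $ 2 * c p - conf p * p $ 1 * b p"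
    "\<And>p. p \<in> poincare_disk \<Longrightarrow>
      partial 1 c p - partial 2 b p = conf p * p $ 1 * a p + conf p * p $ 2 * b p"
proof -
  let ?D = poincare_disk
  have \<phi>: "smooth \<phi>" using assms by (simp add: smooth_isometric_immersion_def)
  note S\<phi> = smooth_partial[OF \<phi>]
  have metric: "partial i \<phi> p \<bullet> partial j \<phi> p = (if i = j then (conf p)\<^sup>2 else 0)" if "p \<in> ?D" for i j p
  proof -
    have "partial i \<phi> p \<bullet> partial j \<phi> p = poincare_metric p (axis i 1) (axis j 1)"
      using assms that unfolding smooth_isometric_immersion_def partial_def by blast
    also have "\<dots> = poincare_coeff p $ i $ j"
      unfolding poincare_metric_def using exhaust_2[of i] exhaust_2[of j] by (auto simp: sum_2 axis_def)
    finally show ?thesis by (simp add: poincare_coeff_def conf_def power_divide)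
  qed
  \<comment> \<open>The metric is conformal, so scaling the coordinate vectors already gives an
    orthonormal frame.\<close>
  define e where "e i p = (1 / conf p) *\<^sub>R partial i \<phi> p" for i p
  define n where "n p = cross3 (e 1 p) (e 2 p)" for p
  have Se: "smooth (e i)" for i
    unfolding e_def[abs_def] using conf_pos
    by (intro disk_smooth_intros smooth_conf S\<phi>) fastforce
  have Sn: "smooth n" unfolding n_def[abs_def] by (intro disk_smooth_intros Se)
  note Sde = smooth_partial[OF Se]
  have orth: "e i p \<bullet> e j p = (if i = j then 1 else 0)" if "p \<in> ?D" for i j p
    using conf_pos[OF that] by (simp add: e_def metric[OF that] power2_eq_square)
  have nn: "e i p \<bullet> n p = 0" "n p \<bullet> e i p = 0" for i p
    using exhaust_2[of i] by (auto simp: n_def dot_cross_self)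
  have nn1: "n p \<bullet> n p = 1" if "p \<in> ?D" for p
    using norm_cross_dot[of "e 1 p" "e 2 p"] orth[OF that]
    by (simp add: n_def power2_norm_eq_inner power_mult_distrib)
  have ex: "v \<bullet> w = (v \<bullet> e 1 p) * (w \<bullet> e 1 p) + (v \<bullet> e 2 p) * (w \<bullet> e 2 p) + (v \<bullet> n p) * (w \<bullet> n p)"
    if "p \<in> ?D" for v w p
    unfolding n_def using orth[OF that] by (intro orthonormal_expansion) auto
  have skew: "partial k (e i) p \<bullet> e j p = - (partial k (e j) p \<bullet> e i p)" if "p \<in> ?D" for i j k p
  proof -
    have "partial k (\<lambda>x. e j x \<bullet> e i x) p = 0"
      using partial_cong[of "\<lambda>x. if j = i then 1 else 0" "\<lambda>x. e j x \<bullet> e i x" p k] orth that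
      by (simp add: disk_smooth_intros partial_const)
    then show ?thesis unfolding partial_inner[OF Se Se that] by (simp add: inner_commute)
  qed
  have skew_n: "partial k n p \<bullet> e j p = - (partial k (e j) p \<bullet> n p)" if "p \<in> ?D" for j k p
  proof -
    have "partial k (\<lambda>x. e j x \<bullet> n x) p = 0" by (simp add: nn partial_const)
    then show ?thesis unfolding partial_inner[OF Se Sn that] by (simp add: inner_commute)
  qed
  have nkn: "partial k n p \<bullet> n p = 0" if "p \<in> ?D" for k p
  proof -
    have "partial k (\<lambda>x. n x \<bullet> n x) p = 0"
      using partial_cong[of "\<lambda>x. 1" "\<lambda>x. n x \<bullet> n x" p k] nn1 that
      by (simp add: disk_smooth_intros partial_const)
    then show ?thesis by (simp add: partial_inner[OF Sn Sn that] inner_commute)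
  qed
  have eei: "partial k (e i) p \<bullet> e i p = 0" if "p \<in> ?D" for i k p
    using skew[OF that, where k = k and i = i and j = i] by simp
  have \<phi>_e: "partial i \<phi> p = conf p *\<^sub>R e i p" if "p \<in> ?D" for i p
    using conf_pos[OF that] by (simp add: e_def)
  \<comment> \<open>Symmetry of the second derivatives of \<phi>. Its components along
    \<open>e 1\<close> and \<open>e 2\<close> give the connection coefficients, the one along
    \<open>n\<close> the symmetry of the second fundamental form.\<close>
  have mixed: "conf p *\<^sub>R partial 1 (e 2) p + partial 1 conf p *\<^sub>R e 2 p
      = conf p *\<^sub>R partial 2 (e 1) p + partial 2 conf p *\<^sub>R e 1 p" if "p \<in> ?D" for p
  proof -
    have "partial k (partial i \<phi>) p = conf p *\<^sub>R partial k (e i) p + partial k conf p *\<^sub>R e i p" for i k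
      using partial_cong[of "\<lambda>x. conf x *\<^sub>R e i x" "partial i \<phi>" p k] \<phi>_e that
      by (simp add: disk_smooth_intros smooth_conf Se partial_scaleR)
    then show ?thesis using partial_commute[OF \<phi> that, of 1 2] by simp
  qed
  have m: "partial 1 (e 1) p \<bullet> e 2 p = - conf p * p $ 2" if "p \<in> ?D" for p
  proof -
    have "conf p * (partial 1 (e 2) p \<bullet> e 1 p) = (conf p)\<^sup>2 * p $ 2"
      using arg_cong[OF mixed[OF that], of "\<lambda>v. v \<bullet> e 1 p"] orth[OF that] eei[OF that]
      by (simp add: inner_add_left partial_conf[OF that])
    then have "partial 1 (e 2) p \<bullet> e 1 p = conf p * p $ 2"
      using conf_pos[OF that] by (simp add: power2_eq_square)
    then show ?thesis using skew[OF that, where k = 1 and i = 1 and j = 2] by simp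
  qed
  have l: "partial 2 (e 1) p \<bullet> e 2 p = conf p * p $ 1" if "p \<in> ?D" for p
  proof -
    have "conf p * (partial 2 (e 1) p \<bullet> e 2 p) = (conf p)\<^sup>2 * p $ 1"
      using arg_cong[OF mixed[OF that], of "\<lambda>v. v \<bullet> e 2 p"] orth[OF that] eei[OF that]
      by (simp add: inner_add_left partial_conf[OF that])
    then show ?thesis
      using conf_pos[OF that] by (simp add: power2_eq_square)
  qed
  have h_sym: "partial 1 (e 2) p \<bullet> n p = partial 2 (e 1) p \<bullet> n p" if "p \<in> ?D" for p
    using arg_cong[OF mixed[OF that], of "\<lambda>v. v \<bullet> n p"] nn conf_pos[OF that]
    by (simp add: inner_add_left)
  define a where "a p = partial 1 (e 1) p \<bullet> n p" for p
  define b where "b p = partial 2 (e 1) p \<bullet> n p" for p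
  define c where "c p = partial 2 (e 2) p \<bullet> n p" for p
  have Sabc: "smooth a" "smooth b" "smooth c"
    unfolding a_def[abs_def] b_def[abs_def] c_def[abs_def] by (intro disk_smooth_intros Sde Sn)+
  have tab: "partial 1 (e 1) p \<bullet> e 1 p = 0" "partial 1 (e 1) p \<bullet> e 2 p = - conf p * p $ 2" "partial 1 (e 1) p \<bullet> n p = a p"
    "partial 2 (e 1) p \<bullet> e 1 p = 0" "partial 2 (e 1) p \<bullet> e 2 p = conf p * p $ 1" "partial 2 (e 1) p \<bullet> n p = b p"
    "partial 1 (e 2) p \<bullet> e 1 p = conf p * p $ 2" "partial 1 (e 2) p \<bullet> e 2 p = 0" "partial 1 (e 2) p \<bullet> n p = b p"
    "partial 2 (e 2) p \<bullet> e 1 p = - conf p * p $ 1" "partial 2 (e 2) p \<bullet> e 2 p = 0" "partial 2 (e 2) p \<bullet> n p = c p"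
    "partial 1 n p \<bullet> e 1 p = - a p" "partial 1 n p \<bullet> e 2 p = - b p" "partial 1 n p \<bullet> n p = 0"
    "partial 2 n p \<bullet> e 1 p = - b p" "partial 2 n p \<bullet> e 2 p = - c p" "partial 2 n p \<bullet> n p = 0" if "p \<in> ?D" for p
    by (simp_all add: eei[OF that] m[OF that] l[OF that] h_sym[OF that] nkn[OF that] skew_n[OF that]
        skew[OF that, where i = 2 and j = 1] a_def b_def c_def)
  show thesis
  proof (rule that[OF Sabc])
    fix p assume p: "p \<in> ?D"
    have d: "partial k (\<lambda>x. partial i (e j) x \<bullet> f x) p = partial i (e j) p \<bullet> partial k f p + partial k (partial i (e j)) p \<bullet> f p"
      if "smooth f" for i j k f
      by (rule partial_inner[OF Sde that p])
    have comm: "partial 2 (partial 1 (e j)) p = partial 1 (partial 2 (e j)) p" for j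
      by (rule partial_commute[OF Se p])
    \<comment> \<open>Once the mixed second derivatives of the frame cancel, only these products of
      first derivatives remain; \<open>ex\<close> evaluates them from the table.\<close>
    have prods: "partial 2 (e 1) p \<bullet> partial 1 n p = - conf p * p $ 1 * b p"
      "partial 1 (e 1) p \<bullet> partial 2 n p = conf p * p $ 2 * c p"
      "partial 2 (e 2) p \<bullet> partial 1 n p = conf p * p $ 1 * a p"
      "partial 1 (e 2) p \<bullet> partial 2 n p = - conf p * p $ 2 * b p"
      "partial 2 (e 1) p \<bullet> partial 1 (e 2) p = (b p)\<^sup>2"
      "partial 1 (e 1) p \<bullet> partial 2 (e 2) p = a p * c p"
      by (subst ex[OF p]; simp add: tab[OF p] power2_eq_square)+
    show "partial 1 b p - partial 2 a p = - conf p * p $ 2 * c p - conf p * p $ 1 * b p"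
      unfolding b_def[abs_def] a_def[abs_def] d[OF Sn] comm prods
      by (simp add: a_def b_def c_def)
    have "partial 2 b p = partial 2 (\<lambda>x. partial 1 (e 2) x \<bullet> n x) p"
      by (rule partial_cong[OF _ _ p]) (use h_sym in \<open>auto simp: b_def intro!: disk_smooth_intros Sde Sn\<close>)
    then show "partial 1 c p - partial 2 b p = conf p * p $ 1 * a p + conf p * p $ 2 * b p"
      unfolding c_def[abs_def] by (simp add: d[OF Sn] comm prods)
    \<comment> \<open>Gauss equation: the connection form is differentiated in two ways, from its
      explicit formula and as the tangential part of the derivative of \<open>e 1\<close>.\<close>
    have "partial 1 (\<lambda>x. conf x * x $ 1) p = partial 1 (\<lambda>x. partial 2 (e 1) x \<bullet> e 2 x) p"
      by (rule partial_cong[OF _ _ p]) (use l in \<open>auto intro!: disk_smooth_intros Sde Se\<close>)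
    moreover have "partial 2 (\<lambda>x. - 1 * (conf x * x $ 2)) p = partial 2 (\<lambda>x. partial 1 (e 1) x \<bullet> e 2 x) p"
      by (rule partial_cong[OF _ _ p]) (use m in \<open>auto intro!: disk_smooth_intros Sde Se\<close>)
    ultimately have "partial 1 (\<lambda>x. conf x * x $ 1) p - partial 2 (\<lambda>x. - 1 * (conf x * x $ 2)) p
        = (b p)\<^sup>2 - a p * c p"
      by (simp add: d[OF Se] comm prods)
    moreover have "partial 2 (\<lambda>x. - 1 * (conf x * x $ 2)) p = - partial 2 (\<lambda>x. conf x * x $ 2) p"
      by (subst partial_mult[OF _ _ p]) (auto simp: partial_const intro!: disk_smooth_intros smooth_conf)
    moreover note conf_curvature[OF p]
    ultimately show "a p * c p - (b p)\<^sup>2 = - (conf p)\<^sup>2"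
      by (simp add: algebra_simps)
  qed
qed

section \<open>Asymptotic directions\<close>

text \<open>\<open>\<beta>\<close> and \<open>\<gamma>\<close> are the angles from the first coordinate axis to the asymptotic directions. Their sum is
  a lift of the argument of the complex number \<open>(a - c) / 2 + i b\<close>, which by the Gauss equation does not
  vanish, and their difference is determined by the mean curvature.\<close>

lemma asymptotic_angles:
  assumes smooth: "smooth a" "smooth b" "smooth c"
    and gauss: "\<And>p. p \<in> poincare_disk \<Longrightarrow> a p * c p - (b p)\<^sup>2 = - (conf p)\<^sup>2"
  obtains \<beta> \<gamma> where "smooth \<beta>" "smooth \<gamma>"
    "\<And>p. 0 < \<gamma> p - \<beta> p" "\<And>p. \<gamma> p - \<beta> p < pi"
    "\<And>p. p \<in> poincare_disk \<Longrightarrow> a p * sin (\<gamma> p - \<beta> p) = conf p * (- 2 * sin (\<beta> p) * sin (\<gamma> p))"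
    "\<And>p. p \<in> poincare_disk \<Longrightarrow> b p * sin (\<gamma> p - \<beta> p) = conf p * sin (\<beta> p + \<gamma> p)"
    "\<And>p. p \<in> poincare_disk \<Longrightarrow> c p * sin (\<gamma> p - \<beta> p) = conf p * (- 2 * cos (\<beta> p) * cos (\<gamma> p))"
proof -
  let ?D = poincare_disk
  define H where "H p = (a p + c p) / (2 * conf p)" for p
  \<comment> \<open>\<open>H\<close> is the mean curvature. This choice makes the cotangent of
    \<Theta> equal to \<open>- H\<close>, and the range of \<open>arctan\<close> puts \<Theta> in
    (0, pi) with no lifting.\<close>
  define \<Theta> where "\<Theta> p = pi / 2 + arctan (H p)" for p
  have nz: "conf p \<noteq> 0" if "p \<in> ?D" for p using conf_pos[OF that] by simp
  have S\<Theta>: "smooth \<Theta>"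
    unfolding \<Theta>_def[abs_def] H_def[abs_def]
    by (intro disk_smooth_intros smooth smooth_conf) (use nz in auto)
  have \<Theta>: "0 < \<Theta> p" "\<Theta> p < pi" for p
    using arctan_bounded[of "H p"] by (auto simp: \<Theta>_def)
  have sin_pos: "sin (\<Theta> p) > 0" for p using \<Theta> by (rule sin_gt_zero)
  have sin_eq: "sin (\<Theta> p) = cos (arctan (H p))" for p by (simp add: \<Theta>_def sin_add)
  have cos_eq: "cos (\<Theta> p) = - H p * sin (\<Theta> p)" for p
  proof -
    have "cos (\<Theta> p) = - sin (arctan (H p))" by (simp add: \<Theta>_def cos_add)
    moreover have "sin (arctan (H p)) = H p * cos (arctan (H p))"
      using tan_arctan[of "H p"] by (simp add: tan_def field_simps)
    ultimately show ?thesis by (simp add: sin_eq)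
  qed
  \<comment> \<open>By the Gauss equation the complex number
    \<open>((a - c) / 2 + i b) / conf\<close> has squared modulus \<open>1 + H\<^sup>2\<close>,
    which is the inverse square of \<open>sin \<Theta>\<close>; so \<open>f1\<close>,
    \<open>f2\<close> are its normalized parts.\<close>
  define f1 where "f1 p = sin (\<Theta> p) * ((a p - c p) / (2 * conf p))" for p
  define f2 where "f2 p = sin (\<Theta> p) * (b p / conf p)" for p
  have Sf: "smooth f1" "smooth f2"
    unfolding f1_def[abs_def] f2_def[abs_def]
    by (intro disk_smooth_intros S\<Theta> smooth smooth_conf; use nz in auto)+
  have unit: "(f1 p)\<^sup>2 + (f2 p)\<^sup>2 = 1" if p: "p \<in> ?D" for p
  proof -
    have "((a p - c p) / (2 * conf p))\<^sup>2 + (b p / conf p)\<^sup>2 = 1 + (H p)\<^sup>2"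
      using nz[OF p] gauss[OF p] by (simp add: H_def field_simps power2_eq_square)
    then have "(f1 p)\<^sup>2 + (f2 p)\<^sup>2 = (sin (\<Theta> p))\<^sup>2 + (H p * sin (\<Theta> p))\<^sup>2"
      unfolding f1_def f2_def by algebra
    then show ?thesis using sin_cos_squared_add[of "\<Theta> p"] by (simp add: cos_eq)
  qed
  obtain \<Sigma> where \<Sigma>: "smooth \<Sigma>" "\<And>p. p \<in> ?D \<Longrightarrow> f1 p = cos (\<Sigma> p)" "\<And>p. p \<in> ?D \<Longrightarrow> f2 p = sin (\<Sigma> p)"
    using unit_circle_lift[OF open_poincare_disk convex_poincare_disk zero_in_poincare_disk Sf unit] by blast
  define \<beta> where "\<beta> p = (\<Sigma> p - \<Theta> p) / 2" for p
  define \<gamma> where "\<gamma> p = (\<Sigma> p + \<Theta> p) / 2" for p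
  have d: "\<gamma> p - \<beta> p = \<Theta> p" "\<beta> p + \<gamma> p = \<Sigma> p" for p by (simp_all add: \<beta>_def \<gamma>_def field_simps)
  have "a p * sin (\<Theta> p) = conf p * (cos (\<Sigma> p) - cos (\<Theta> p))"
    "b p * sin (\<Theta> p) = conf p * sin (\<Sigma> p)"
    "c p * sin (\<Theta> p) = - conf p * (cos (\<Sigma> p) + cos (\<Theta> p))" if p: "p \<in> ?D" for p
  proof -
    have 1: "(a p - c p) * sin (\<Theta> p) = 2 * conf p * cos (\<Sigma> p)"
      using \<Sigma>(2)[OF p] nz[OF p] by (simp add: f1_def field_simps)
    have 2: "(a p + c p) * sin (\<Theta> p) = - 2 * conf p * cos (\<Theta> p)"
      using nz[OF p] by (simp add: cos_eq H_def)
    show "a p * sin (\<Theta> p) = conf p * (cos (\<Sigma> p) - cos (\<Theta> p))"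
      "c p * sin (\<Theta> p) = - conf p * (cos (\<Sigma> p) + cos (\<Theta> p))"
      using 1 2 by algebra+
    show "b p * sin (\<Theta> p) = conf p * sin (\<Sigma> p)"
      using \<Sigma>(3)[OF p] nz[OF p] by (simp add: f2_def field_simps)
  qed
  moreover have "cos (\<Sigma> p) - cos (\<Theta> p) = - 2 * sin (\<beta> p) * sin (\<gamma> p)"
    "cos (\<Sigma> p) + cos (\<Theta> p) = 2 * cos (\<beta> p) * cos (\<gamma> p)" for p
    by (simp_all flip: d add: cos_add cos_diff)
  ultimately have eqs: "a p * sin (\<gamma> p - \<beta> p) = conf p * (- 2 * sin (\<beta> p) * sin (\<gamma> p))"
    "b p * sin (\<gamma> p - \<beta> p) = conf p * sin (\<beta> p + \<gamma> p)"
    "c p * sin (\<gamma> p - \<beta> p) = conf p * (- 2 * cos (\<beta> p) * cos (\<gamma> p))" if "p \<in> ?D" for p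
    using that by (simp_all add: d)
  have sm: "smooth \<beta>" "smooth \<gamma>"
    unfolding \<beta>_def[abs_def] \<gamma>_def[abs_def] by (intro disk_smooth_intros \<Sigma>(1) S\<Theta>; simp)+
  have rg: "0 < \<gamma> p - \<beta> p" "\<gamma> p - \<beta> p < pi" for p
    using \<Theta> by (simp_all add: d)
  show thesis by (rule that[OF sm rg eqs])
qed

section \<open>Parallel asymptotic directions and the sine-Gordon system on the disk\<close>

lemma partial_add:
  assumes "smooth f" "smooth g" "p \<in> poincare_disk"
  shows "partial i (\<lambda>x. f x + g x) p = partial i f p + partial i g p"
  unfolding partial_def[of i f] partial_def[of i g]
  by (rule partial_eqI[OF has_derivative_add[OF C_infinity_onD(1)[OF assms(1,3)] C_infinity_onD(1)[OF assms(2,3)]]])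

lemma partial_diff:
  assumes "smooth f" "smooth g" "p \<in> poincare_disk"
  shows "partial i (\<lambda>x. f x - g x) p = partial i f p - partial i g p"
  unfolding partial_def[of i f] partial_def[of i g]
  by (rule partial_eqI[OF has_derivative_diff[OF C_infinity_onD(1)[OF assms(1,3)] C_infinity_onD(1)[OF assms(2,3)]]])

lemma partial_sin:
  fixes f :: "real^2 \<Rightarrow> real"
  assumes "smooth f" "p \<in> poincare_disk"
  shows "partial i (\<lambda>x. sin (f x)) p = partial i f p * cos (f p)"
  unfolding partial_def[of i f]
  by (rule partial_eqI[OF DERIV_compose_FDERIV[OF DERIV_sin C_infinity_onD(1)[OF assms]]])

lemma partial_cos:
  fixes f :: "real^2 \<Rightarrow> real"
  assumes "smooth f" "p \<in> poincare_disk"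
  shows "partial i (\<lambda>x. cos (f x)) p = - partial i f p * sin (f p)"
  unfolding partial_def[of i f]
  using partial_eqI[OF DERIV_compose_FDERIV[OF DERIV_cos C_infinity_onD(1)[OF assms]]] by simp

text \<open>The quotient rule with denominators cleared, so that what follows consists of polynomial
  identities for \<open>algebra\<close>.\<close>

lemma partial_quotient:
  fixes f g h :: "real^2 \<Rightarrow> real"
  assumes "smooth f" "smooth g" "smooth h" "p \<in> poincare_disk"
    and "\<And>x. x \<in> poincare_disk \<Longrightarrow> f x * h x = g x"
  shows "partial i f p * (h p)\<^sup>2 = partial i g p * h p - g p * partial i h p"
proof -
  have "partial i g p = partial i (\<lambda>x. f x * h x) p"
    by (rule partial_cong[OF assms(5) _ assms(4)]) (auto intro: disk_smooth_intros assms(1,3))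
  then have "partial i g p = f p * partial i h p + partial i f p * h p"
    using assms by (simp add: partial_mult)
  then show ?thesis using assms(5)[OF assms(4), symmetric] by (simp add: algebra_simps power2_eq_square)
qed

text \<open>\<open>second_form\<close> says that the directions at angles \<beta> and \<gamma> are
  the zeros of the second fundamental form; it contains the Gauss equation, as its right sides give
  \<open>a c - b\<^sup>2 = - conf\<^sup>2\<close> after division by the squared sine.\<close>

locale asymptotic_angles =
  fixes a b c \<beta> \<gamma> :: "real^2 \<Rightarrow> real"
  assumes smooth_abc: "smooth a" "smooth b" "smooth c"
    and codazzi:
      "\<And>p. p \<in> poincare_disk \<Longrightarrow>
        partial 1 b p - partial 2 a p = - conf p * p $ 2 * c p - conf p * p $ 1 * b p"
      "\<And>p. p \<in> poincare_disk \<Longrightarrow>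
        partial 1 c p - partial 2 b p = conf p * p $ 1 * a p + conf p * p $ 2 * b p"
    and smooth_angle: "smooth \<beta>" "smooth \<gamma>"
    and angle_range: "\<And>p. 0 < \<gamma> p - \<beta> p" "\<And>p. \<gamma> p - \<beta> p < pi"
    and second_form:
      "\<And>p. p \<in> poincare_disk \<Longrightarrow> a p * sin (\<gamma> p - \<beta> p) = conf p * (- 2 * sin (\<beta> p) * sin (\<gamma> p))"
      "\<And>p. p \<in> poincare_disk \<Longrightarrow> b p * sin (\<gamma> p - \<beta> p) = conf p * sin (\<beta> p + \<gamma> p)"
      "\<And>p. p \<in> poincare_disk \<Longrightarrow> c p * sin (\<gamma> p - \<beta> p) = conf p * (- 2 * cos (\<beta> p) * cos (\<gamma> p))"
begin

abbreviation "\<Theta> p \<equiv> \<gamma> p - \<beta> p"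

lemma sin_\<Theta>_pos: "sin (\<Theta> p) > 0"
  using angle_range by (rule sin_gt_zero)

lemma smooth_sin_\<Theta>: "smooth (\<lambda>p. sin (\<Theta> p))"
  by (intro disk_smooth_intros smooth_angle)

lemma partial_sin_\<Theta>:
  "p \<in> poincare_disk \<Longrightarrow> partial i (\<lambda>p. sin (\<Theta> p)) p = (partial i \<gamma> p - partial i \<beta> p) * cos (\<Theta> p)"
  by (subst partial_sin) (auto simp: partial_diff smooth_angle intro: disk_smooth_intros)

lemmas angle_simps = partial_mult partial_sin partial_cos partial_const disk_smooth_intros
  smooth_conf smooth_angle partial_add partial_diff

text \<open>Each of the two asymptotic directions is parallel along the other one.\<close>

lemma parallel:
  assumes p: "p \<in> poincare_disk"
  shows "(partial 1 \<beta> p - conf p * p $ 2) * cos (\<gamma> p) + (partial 2 \<beta> p + conf p * p $ 1) * sin (\<gamma> p) = 0" (is "?Y = 0")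
    and "(partial 1 \<gamma> p - conf p * p $ 2) * cos (\<beta> p) + (partial 2 \<gamma> p + conf p * p $ 1) * sin (\<beta> p) = 0" (is "?X = 0")
proof -
  let ?S = "sin (\<Theta> p)" let ?l = "conf p"
  let ?sb = "sin (\<beta> p)" let ?cb = "cos (\<beta> p)" let ?sg = "sin (\<gamma> p)" let ?cg = "cos (\<gamma> p)"
  note trig = sin_cos_squared_add[of "\<beta> p"] sin_cos_squared_add[of "\<gamma> p"]
  \<comment> \<open>Derivatives of the coefficients of the second fundamental form in terms of the
    angles, times the squared sine of \<Theta>.\<close>
  have da: "partial i a p * ?S\<^sup>2 = - 2 * partial i conf p * ?sb * ?sg * ?S
      + 2 * ?l * (?sb\<^sup>2 * partial i \<gamma> p - ?sg\<^sup>2 * partial i \<beta> p)" for i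
  proof -
    have "partial i a p * ?S\<^sup>2 = partial i (\<lambda>p. conf p * (- 2 * sin (\<beta> p) * sin (\<gamma> p))) p * ?S
        - ?l * (- 2 * ?sb * ?sg) * partial i (\<lambda>p. sin (\<Theta> p)) p"
      by (rule partial_quotient[OF smooth_abc(1) _ smooth_sin_\<Theta> p second_form(1)])
        (intro disk_smooth_intros smooth_conf smooth_angle)
    also have "\<dots> = - 2 * (partial i conf p * ?sb * ?sg + ?l * (?cb * partial i \<beta> p * ?sg + ?sb * (?cg * partial i \<gamma> p))) * ?S
        + 2 * ?l * ?sb * ?sg * (partial i \<gamma> p - partial i \<beta> p) * cos (\<Theta> p)"
      by (simp only: angle_simps p partial_sin_\<Theta>) (simp add: algebra_simps)
    also have "\<dots> = - 2 * partial i conf p * ?sb * ?sg * ?S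
      + 2 * ?l * (?sb\<^sup>2 * partial i \<gamma> p - ?sg\<^sup>2 * partial i \<beta> p)"
      unfolding sin_diff cos_diff using trig by algebra
    finally show ?thesis .
  qed
  have dc: "partial i c p * ?S\<^sup>2 = - 2 * partial i conf p * ?cb * ?cg * ?S
      + 2 * ?l * (?cb\<^sup>2 * partial i \<gamma> p - ?cg\<^sup>2 * partial i \<beta> p)" for i
  proof -
    have "partial i c p * ?S\<^sup>2 = partial i (\<lambda>p. conf p * (- 2 * cos (\<beta> p) * cos (\<gamma> p))) p * ?S
        - ?l * (- 2 * ?cb * ?cg) * partial i (\<lambda>p. sin (\<Theta> p)) p"
      by (rule partial_quotient[OF smooth_abc(3) _ smooth_sin_\<Theta> p second_form(3)])
        (intro disk_smooth_intros smooth_conf smooth_angle)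
    also have "\<dots> = - 2 * (partial i conf p * ?cb * ?cg - ?l * (?sb * partial i \<beta> p * ?cg + ?cb * (?sg * partial i \<gamma> p))) * ?S
        + 2 * ?l * ?cb * ?cg * (partial i \<gamma> p - partial i \<beta> p) * cos (\<Theta> p)"
      by (simp only: angle_simps p partial_sin_\<Theta>) (simp add: algebra_simps)
    also have "\<dots> = - 2 * partial i conf p * ?cb * ?cg * ?S
      + 2 * ?l * (?cb\<^sup>2 * partial i \<gamma> p - ?cg\<^sup>2 * partial i \<beta> p)"
      unfolding sin_diff cos_diff using trig by algebra
    finally show ?thesis .
  qed
  have db: "partial i b p * ?S\<^sup>2 = partial i conf p * (?sb * ?cg + ?cb * ?sg) * ?S
      + 2 * ?l * (?sg * ?cg * partial i \<beta> p - ?sb * ?cb * partial i \<gamma> p)" for i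
  proof -
    have "partial i b p * ?S\<^sup>2 = partial i (\<lambda>p. conf p * sin (\<beta> p + \<gamma> p)) p * ?S
        - ?l * sin (\<beta> p + \<gamma> p) * partial i (\<lambda>p. sin (\<Theta> p)) p"
      by (rule partial_quotient[OF smooth_abc(2) _ smooth_sin_\<Theta> p second_form(2)])
        (intro disk_smooth_intros smooth_conf smooth_angle)
    also have "\<dots> = (partial i conf p * sin (\<beta> p + \<gamma> p) + ?l * (cos (\<beta> p + \<gamma> p) * (partial i \<beta> p + partial i \<gamma> p))) * ?S
        - ?l * sin (\<beta> p + \<gamma> p) * (partial i \<gamma> p - partial i \<beta> p) * cos (\<Theta> p)"
      by (simp only: angle_simps p partial_sin_\<Theta>) (simp add: algebra_simps)
    also have "\<dots> = partial i conf p * (?sb * ?cg + ?cb * ?sg) * ?S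
      + 2 * ?l * (?sg * ?cg * partial i \<beta> p - ?sb * ?cb * partial i \<gamma> p)"
      unfolding sin_diff cos_diff sin_add cos_add using trig by algebra
    finally show ?thesis .
  qed
  have S: "?S = ?sg * ?cb - ?cg * ?sb" by (rule sin_diff)
  note sf = second_form[OF p, unfolded sin_add]
  have l: "?l \<noteq> 0" using conf_pos[OF p] by simp
  \<comment> \<open>In terms of the angles, the Codazzi equations are two linear equations for
    \<open>?X\<close> and \<open>?Y\<close> whose determinant is \<open>sin \<Theta>\<close>, which
    is nonzero.\<close>
  have "?l * (?sg * ?Y - ?sb * ?X) = 0"
    using codazzi(1)[OF p] da[of 2] db[of 1] sf trig S
    unfolding partial_conf[OF p] by algebra
  moreover have "?l * (?cb * ?X - ?cg * ?Y) = 0"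
    using codazzi(2)[OF p] db[of 2] dc[of 1] sf trig S
    unfolding partial_conf[OF p] by algebra
  ultimately have 1: "?sg * ?Y - ?sb * ?X = 0" and 2: "?cb * ?X - ?cg * ?Y = 0"
    using l by simp_all
  have "?S * ?Y = 0" "?S * ?X = 0" using 1 2 S by algebra+
  then show "?Y = 0" "?X = 0" using sin_\<Theta>_pos[of p] by simp_all
qed

text \<open>The coframe dual to the unit vectors in the asymptotic directions.\<close>

definition "U1 p = conf p * sin (\<gamma> p) / sin (\<Theta> p)"
definition "U2 p = - conf p * cos (\<gamma> p) / sin (\<Theta> p)"
definition "W1 p = - conf p * sin (\<beta> p) / sin (\<Theta> p)"
definition "W2 p = conf p * cos (\<beta> p) / sin (\<Theta> p)"

lemma sin_\<Theta>_ne: "sin (\<Theta> p) \<noteq> 0"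
  using sin_\<Theta>_pos[of p] by simp

lemma smooth_coframe: "smooth U1" "smooth U2" "smooth W1" "smooth W2"
  unfolding U1_def[abs_def] U2_def[abs_def] W1_def[abs_def] W2_def[abs_def]
  by (intro disk_smooth_intros smooth_conf smooth_angle; simp add: sin_\<Theta>_ne)+

text \<open>With X and Y the unit asymptotic fields, parallelism and vanishing torsion make their
  bracket zero, which is closedness of the dual coframe. In coordinates the differential is a
  combination of the two expressions of \<open>parallel\<close>.\<close>

lemma closed_U:
  assumes p: "p \<in> poincare_disk"
  shows "partial 2 U1 p = partial 1 U2 p"
proof -
  let ?S = "sin (\<Theta> p)" and ?C = "cos (\<Theta> p)" and ?l = "conf p" and ?s = "sin (\<gamma> p)" and ?c = "cos (\<gamma> p)"
  have g: "smooth (\<lambda>p. conf p * sin (\<gamma> p))" "smooth (\<lambda>p. - 1 * (conf p * cos (\<gamma> p)))"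
    by (intro disk_smooth_intros smooth_conf smooth_angle)+
  have "partial 2 U1 p * ?S\<^sup>2 = partial 2 (\<lambda>p. conf p * sin (\<gamma> p)) p * ?S - ?l * ?s * partial 2 (\<lambda>p. sin (\<Theta> p)) p"
    by (rule partial_quotient[OF smooth_coframe(1) g(1) smooth_sin_\<Theta> p]) (simp add: U1_def sin_\<Theta>_ne)
  then have 1: "partial 2 U1 p * ?S\<^sup>2 = (partial 2 conf p * ?s + ?l * (partial 2 \<gamma> p * ?c)) * ?S
      - ?l * ?s * ((partial 2 \<gamma> p - partial 2 \<beta> p) * ?C)"
    by (simp only: angle_simps p) (simp add: algebra_simps)
  have "partial 1 U2 p * ?S\<^sup>2 = partial 1 (\<lambda>p. - 1 * (conf p * cos (\<gamma> p))) p * ?S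
      - (- 1 * (?l * ?c)) * partial 1 (\<lambda>p. sin (\<Theta> p)) p"
    by (rule partial_quotient[OF smooth_coframe(2) g(2) smooth_sin_\<Theta> p]) (simp add: U2_def sin_\<Theta>_ne)
  then have 2: "partial 1 U2 p * ?S\<^sup>2 = (?l * (partial 1 \<gamma> p * ?s) - partial 1 conf p * ?c) * ?S
      + ?l * ?c * ((partial 1 \<gamma> p - partial 1 \<beta> p) * ?C)"
    by (simp only: angle_simps p) (simp add: algebra_simps)
  \<comment> \<open>Writing \<beta> as \<open>\<gamma> - \<Theta>\<close> leaves only the sines and
    cosines of \<gamma> and \<Theta> in the identity.\<close>
  have b: "cos (\<beta> p) = ?C * ?c + ?S * ?s" "sin (\<beta> p) = ?C * ?s - ?S * ?c"
    using cos_diff[of "\<gamma> p" "\<Theta> p"] sin_diff[of "\<gamma> p" "\<Theta> p"] by simp_all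
  have "partial 1 U2 p * ?S\<^sup>2 - partial 2 U1 p * ?S\<^sup>2 =
      ?l * (((partial 1 \<gamma> p - ?l * p $ 2) * cos (\<beta> p) + (partial 2 \<gamma> p + ?l * p $ 1) * sin (\<beta> p))
        - ?C * ((partial 1 \<beta> p - ?l * p $ 2) * ?c + (partial 2 \<beta> p + ?l * p $ 1) * ?s))"
    unfolding 1 2 b partial_conf[OF p] by algebra
  then have "(partial 1 U2 p - partial 2 U1 p) * ?S\<^sup>2 = 0"
    unfolding parallel[OF p] by (simp add: algebra_simps)
  then show ?thesis using sin_\<Theta>_ne by simp
qed

text \<open>As for \<open>closed_U\<close>, with \<beta> and \<gamma> exchanged.\<close>

lemma closed_W:
  assumes p: "p \<in> poincare_disk"
  shows "partial 2 W1 p = partial 1 W2 p"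
proof -
  let ?S = "sin (\<Theta> p)" and ?C = "cos (\<Theta> p)" and ?l = "conf p" and ?s = "sin (\<beta> p)" and ?c = "cos (\<beta> p)"
  have g: "smooth (\<lambda>p. - 1 * (conf p * sin (\<beta> p)))" "smooth (\<lambda>p. conf p * cos (\<beta> p))"
    by (intro disk_smooth_intros smooth_conf smooth_angle)+
  have "partial 2 W1 p * ?S\<^sup>2 = partial 2 (\<lambda>p. - 1 * (conf p * sin (\<beta> p))) p * ?S
      - (- 1 * (?l * ?s)) * partial 2 (\<lambda>p. sin (\<Theta> p)) p"
    by (rule partial_quotient[OF smooth_coframe(3) g(1) smooth_sin_\<Theta> p]) (simp add: W1_def sin_\<Theta>_ne)
  then have 1: "partial 2 W1 p * ?S\<^sup>2 = - (partial 2 conf p * ?s + ?l * (partial 2 \<beta> p * ?c)) * ?S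
      + ?l * ?s * ((partial 2 \<gamma> p - partial 2 \<beta> p) * ?C)"
    by (simp only: angle_simps p) (simp add: algebra_simps)
  have "partial 1 W2 p * ?S\<^sup>2 = partial 1 (\<lambda>p. conf p * cos (\<beta> p)) p * ?S - ?l * ?c * partial 1 (\<lambda>p. sin (\<Theta> p)) p"
    by (rule partial_quotient[OF smooth_coframe(4) g(2) smooth_sin_\<Theta> p]) (simp add: W2_def sin_\<Theta>_ne)
  then have 2: "partial 1 W2 p * ?S\<^sup>2 = (partial 1 conf p * ?c - ?l * (partial 1 \<beta> p * ?s)) * ?S
      - ?l * ?c * ((partial 1 \<gamma> p - partial 1 \<beta> p) * ?C)"
    by (simp only: angle_simps p) (simp add: algebra_simps)
  have b: "cos (\<gamma> p) = ?C * ?c - ?S * ?s" "sin (\<gamma> p) = ?C * ?s + ?S * ?c"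
    using cos_add[of "\<beta> p" "\<Theta> p"] sin_add[of "\<beta> p" "\<Theta> p"] by simp_all
  have "partial 1 W2 p * ?S\<^sup>2 - partial 2 W1 p * ?S\<^sup>2 =
      ?l * (((partial 1 \<beta> p - ?l * p $ 2) * cos (\<gamma> p) + (partial 2 \<beta> p + ?l * p $ 1) * sin (\<gamma> p))
        - ?C * ((partial 1 \<gamma> p - ?l * p $ 2) * ?c + (partial 2 \<gamma> p + ?l * p $ 1) * ?s))"
    unfolding 1 2 b partial_conf[OF p] by algebra
  then have "(partial 1 W2 p - partial 2 W1 p) * ?S\<^sup>2 = 0"
    unfolding parallel[OF p] by (simp add: algebra_simps)
  then show ?thesis using sin_\<Theta>_ne by simp
qed

text \<open>By parallelism, \<open>d\<beta>\<close> plus the connection form is a multiple of \<open>(U1, U2)\<close>; the factor is \<open>- P\<close>.\<close>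

definition "P p = sin (\<Theta> p) / conf p *
  ((partial 2 \<beta> p + conf p * p $ 1) * cos (\<gamma> p) - (partial 1 \<beta> p - conf p * p $ 2) * sin (\<gamma> p))"

lemma smooth_P: "smooth P"
  unfolding P_def[abs_def] using conf_pos
  by (intro disk_smooth_intros smooth_angle smooth_partial smooth_conf) fastforce

text \<open>Along X, the unit vector at angle \<beta>, the derivative of \<gamma> cancels the
  connection form. So the derivative of \<Theta> is minus that of \<beta> plus the connection form,
  which is \<open>P\<close> because \<open>(U1, U2)\<close> takes the value 1 on X.\<close>

lemma P_eq_derivative_\<Theta>:
  assumes p: "p \<in> poincare_disk"
  shows "P p = (partial 1 (\<lambda>p. \<Theta> p) p * cos (\<beta> p) + partial 2 (\<lambda>p. \<Theta> p) p * sin (\<beta> p)) / conf p"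
proof -
  let ?A = "partial 1 \<beta> p - conf p * p $ 2" and ?B = "partial 2 \<beta> p + conf p * p $ 1"
  note trig = sin_cos_squared_add[of "\<gamma> p"]
  have "partial 1 (\<lambda>p. \<Theta> p) p * cos (\<beta> p) + partial 2 (\<lambda>p. \<Theta> p) p * sin (\<beta> p)
      = - (?A * cos (\<beta> p) + ?B * sin (\<beta> p))"
    using parallel(2)[OF p] by (simp add: partial_diff smooth_angle p algebra_simps)
  also have "\<dots> = sin (\<Theta> p) * (?B * cos (\<gamma> p) - ?A * sin (\<gamma> p))"
    using parallel(1)[OF p] trig unfolding sin_diff by algebra
  finally show ?thesis by (simp add: P_def)
qed

text \<open>Differentiate d\<beta> + \<omega> = - P U, where \<omega> is the connection form and U
  is closed. On the left remains the area form, which is sin \<Theta> times the wedge product of U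
  and W; on the right, the derivative of \<open>P\<close> along Y times that product.\<close>

lemma derivative_P:
  assumes p: "p \<in> poincare_disk"
  shows "(partial 1 P p * cos (\<gamma> p) + partial 2 P p * sin (\<gamma> p)) / conf p = sin (\<Theta> p)"
proof -
  have PU: "partial 1 \<beta> x - conf x * x $ 2 = - P x * U1 x" "partial 2 \<beta> x + conf x * x $ 1 = - P x * U2 x"
    if x: "x \<in> poincare_disk" for x
  proof -
    let ?A = "partial 1 \<beta> x - conf x * x $ 2" and ?B = "partial 2 \<beta> x + conf x * x $ 1"
    note trig = sin_cos_squared_add[of "\<gamma> x"]
    have PU: "P x * U1 x = (?B * cos (\<gamma> x) - ?A * sin (\<gamma> x)) * sin (\<gamma> x)"
      "P x * U2 x = - ((?B * cos (\<gamma> x) - ?A * sin (\<gamma> x)) * cos (\<gamma> x))"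
      using conf_pos[OF x] sin_\<Theta>_ne[of x] by (simp_all add: P_def U1_def U2_def)
    show "?A = - P x * U1 x" "?B = - P x * U2 x"
      using PU parallel(1)[OF x] trig by algebra+
  qed
  note sm = smooth_partial[OF smooth_angle(1)] smooth_conf smooth_P smooth_coframe
  have "partial 2 (\<lambda>x. partial 1 \<beta> x - conf x * x $ 2) p = partial 2 (\<lambda>x. - 1 * (P x * U1 x)) p"
    by (rule partial_cong[OF _ _ p]) (use PU in \<open>auto intro!: disk_smooth_intros sm\<close>)
  also have "\<dots> = - (partial 2 P p * U1 p + P p * partial 2 U1 p)"
    by (subst partial_mult[OF _ _ p]; (intro disk_smooth_intros sm)?)+ (simp add: partial_const)
  finally have 1: "partial 2 (partial 1 \<beta>) p - partial 2 (\<lambda>x. conf x * x $ 2) p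
      = - (partial 2 P p * U1 p + P p * partial 2 U1 p)"
    by (subst (asm) partial_diff[OF _ _ p]) (intro disk_smooth_intros sm)+
  have "partial 1 (\<lambda>x. partial 2 \<beta> x + conf x * x $ 1) p = partial 1 (\<lambda>x. - 1 * (P x * U2 x)) p"
    by (rule partial_cong[OF _ _ p]) (use PU in \<open>auto intro!: disk_smooth_intros sm\<close>)
  also have "\<dots> = - (partial 1 P p * U2 p + P p * partial 1 U2 p)"
    by (subst partial_mult[OF _ _ p]; (intro disk_smooth_intros sm)?)+ (simp add: partial_const)
  finally have 2: "partial 1 (partial 2 \<beta>) p + partial 1 (\<lambda>x. conf x * x $ 1) p
      = - (partial 1 P p * U2 p + P p * partial 1 U2 p)"
    by (subst (asm) partial_add[OF _ _ p]) (intro disk_smooth_intros sm)+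
  have "(conf p)\<^sup>2 = partial 2 P p * U1 p - partial 1 P p * U2 p"
    using 1 2 conf_curvature[OF p] closed_U[OF p] partial_commute[OF smooth_angle(1) p, of 1 2] by simp
  also have "\<dots> = conf p / sin (\<Theta> p) * (partial 1 P p * cos (\<gamma> p) + partial 2 P p * sin (\<gamma> p))"
    unfolding U1_def U2_def by (simp add: algebra_simps add_divide_distrib)
  finally have "conf p * (conf p * sin (\<Theta> p)) = conf p * (partial 1 P p * cos (\<gamma> p) + partial 2 P p * sin (\<gamma> p))"
    using sin_\<Theta>_ne[of p] by (simp add: field_simps power2_eq_square)
  then have "conf p * sin (\<Theta> p) = partial 1 P p * cos (\<gamma> p) + partial 2 P p * sin (\<gamma> p)"
    using conf_pos[OF p] by (simp only: mult_cancel_left) simp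
  then show ?thesis using conf_pos[OF p] by (simp add: divide_eq_eq mult.commute)
qed

end

section \<open>Chebyshev coordinates\<close>

lemma smooth_locally_injective:
  fixes F :: "'a::euclidean_space \<Rightarrow> 'b::euclidean_space"
  assumes S: "open S" "a \<in> S" and F: "C_infinity_on F S"
    and g': "linear g'" "\<And>v. g' (frechet_derivative F (at a) v) = v"
  shows "\<exists>r>0. inj_on F (ball a r)"
proof -
  let ?F' = "\<lambda>x. frechet_derivative F (at x)"
  \<comment> \<open>The local injectivity theorem wants continuity of the derivative in operator
    norm, while smoothness gives it for each fixed vector; the sum over the basis bounds the
    operator norm.\<close>
  define q where "q x = (\<Sum>b\<in>Basis. norm (?F' x b - ?F' a b))" for x
  have "continuous_on S q"
    unfolding q_def by (intro continuous_intros C_infinity_onD(3)[OF C_infinity_onD(2)[OF F]])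
  then have "isCont q a" using S by (simp add: continuous_on_eq_continuous_at)
  have bound: "onorm (\<lambda>v. ?F' x v - ?F' a v) \<le> q x" if "x \<in> S" for x
  proof (rule onorm_bound)
    show "0 \<le> q x" by (simp add: q_def sum_nonneg)
    fix v :: 'a
    have lin: "linear (\<lambda>v. ?F' x v - ?F' a v)"
      by (intro linear_compose_sub has_derivative_linear[OF C_infinity_onD(1)[OF F]] that S)
    have "norm (?F' x v - ?F' a v) = norm (\<Sum>b\<in>Basis. (v \<bullet> b) *\<^sub>R (?F' x b - ?F' a b))"
      using linear_sum[OF lin, of "\<lambda>b. (v \<bullet> b) *\<^sub>R b" Basis] linear_cmul[OF lin]
      by (simp add: euclidean_representation)
    also have "\<dots> \<le> (\<Sum>b\<in>Basis. norm v * norm (?F' x b - ?F' a b))"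
      by (intro sum_norm_le) (simp add: mult_right_mono Basis_le_norm)
    finally show "norm (?F' x v - ?F' a v) \<le> q x * norm v"
      by (simp add: q_def sum_distrib_left mult.commute)
  qed
  have "\<exists>d>0. \<forall>x. dist a x < d \<longrightarrow> onorm (\<lambda>v. ?F' x v - ?F' a v) < e" if "e > 0" for e
  proof -
    have "q a = 0" by (simp add: q_def)
    then obtain d1 where d1: "d1 > 0" "\<And>x. dist x a < d1 \<Longrightarrow> q x < e"
      using \<open>isCont q a\<close> \<open>e > 0\<close> unfolding continuous_at_eps_delta dist_real_def by fastforce
    obtain d2 where d2: "d2 > 0" "ball a d2 \<subseteq> S" using S by (meson openE)
    have "onorm (\<lambda>v. ?F' x v - ?F' a v) < e" if "dist a x < min d1 d2" for x
      using bound[of x] d1(2)[of x] d2(2) that by (auto simp: dist_commute intro: le_less_trans)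
    then show ?thesis using d1(1) d2(1) by (intro exI[of _ "min d1 d2"]) auto
  qed
  moreover have "g' \<circ> ?F' a = id" using g'(2) by auto
  ultimately show ?thesis
    using has_derivative_locally_injective[OF S(2,1) _ _ C_infinity_onD(1)[OF F], of g'] g'(1)
      linear_conv_bounded_linear by metis
qed

lemma potential_on_disk:
  assumes U: "smooth U1" "smooth U2"
    and closed: "\<And>p. p \<in> poincare_disk \<Longrightarrow> partial 2 U1 p = partial 1 (U2 :: real^2 \<Rightarrow> real) p"
  obtains u where "smooth u"
    "\<And>p. p \<in> poincare_disk \<Longrightarrow> (u has_derivative (\<lambda>v. v $ 1 * U1 p + v $ 2 * U2 p)) (at p)"
proof (rule closed_form_has_potential[OF open_poincare_disk convex_poincare_disk zero_in_poincare_disk,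
      of "\<lambda>p v. v $ 1 * U1 p + v $ 2 * U2 p"])
  show "linear (\<lambda>v. v $ 1 * U1 p + v $ 2 * U2 p)" for p
    by (auto simp: linear_iff algebra_simps)
  show "smooth (\<lambda>p. v $ 1 * U1 p + v $ 2 * U2 p)" for v
    by (intro disk_smooth_intros U)
  fix p v w assume p: "p \<in> poincare_disk"
  have "((\<lambda>p. v $ 1 * U1 p + v $ 2 * U2 p) has_derivative
      (\<lambda>w. v $ 1 * (w $ 1 *\<^sub>R partial 1 U1 p + w $ 2 *\<^sub>R partial 2 U1 p)
         + v $ 2 * (w $ 1 *\<^sub>R partial 1 U2 p + w $ 2 *\<^sub>R partial 2 U2 p))) (at p)" for v :: "real^2"
    by (intro has_derivative_add has_derivative_mult_right has_derivative_partial U p)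
  from this[THEN frechet_derivative_at, symmetric]
  show "frechet_derivative (\<lambda>p. v $ 1 * U1 p + v $ 2 * U2 p) (at p) w
      = frechet_derivative (\<lambda>p. w $ 1 * U1 p + w $ 2 * U2 p) (at p) v"
    by (simp add: closed[OF p] algebra_simps)
qed (rule that)

definition direction :: "real \<Rightarrow> real^2" where
  "direction t = cos t *\<^sub>R axis 1 1 + sin t *\<^sub>R axis 2 1"

lemma direction_component [simp]: "direction t $ 1 = cos t" "direction t $ 2 = sin t"
  by (simp_all add: direction_def axis_def)

lemma norm_direction [simp]: "norm (direction t) = 1"
  by (simp add: norm_eq_1 inner_vec_def sum_2 flip: power2_eq_square)

text \<open>In exponential form the inequality itself forces \<open>p\<close> into the disk, so the
  set is closed in the plane.\<close>

lemma compact_disk_sublevel: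
  "compact {p \<in> poincare_disk. - ln (1 - (p$1)\<^sup>2 - (p$2)\<^sup>2) \<le> M}"
proof -
  have eq: "{p \<in> poincare_disk. - ln (1 - (p$1)\<^sup>2 - (p$2)\<^sup>2) \<le> M}
      = {p. exp (- M) \<le> 1 - (p$1)\<^sup>2 - (p$2)\<^sup>2}"
  proof (intro set_eqI)
    fix p :: "real^2"
    show "p \<in> {p \<in> poincare_disk. - ln (1 - (p$1)\<^sup>2 - (p$2)\<^sup>2) \<le> M}
        \<longleftrightarrow> p \<in> {p. exp (- M) \<le> 1 - (p$1)\<^sup>2 - (p$2)\<^sup>2}"
    proof (cases "1 - (p$1)\<^sup>2 - (p$2)\<^sup>2 > 0")
      case True
      then show ?thesis using ln_ge_iff[OF True, of "- M"] by (auto simp: poincare_disk_def)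
    next
      case False
      then have "\<not> exp (- M) \<le> 1 - (p$1)\<^sup>2 - (p$2)\<^sup>2" using exp_gt_zero[of "- M"] by linarith
      then show ?thesis using False by (auto simp: poincare_disk_def)
    qed
  qed
  have "closed {p :: real^2. exp (- M) \<le> 1 - (p$1)\<^sup>2 - (p$2)\<^sup>2}"
    by (intro closed_Collect_le continuous_intros)
  moreover have "{p \<in> poincare_disk. - ln (1 - (p$1)\<^sup>2 - (p$2)\<^sup>2) \<le> M} \<subseteq> ball 0 1"
    by (auto simp: poincare_disk_eq_ball)
  then have "bounded {p \<in> poincare_disk. - ln (1 - (p$1)\<^sup>2 - (p$2)\<^sup>2) \<le> M}"
    using bounded_ball bounded_subset by blast
  ultimately show ?thesis using eq by (simp add: compact_eq_bounded_closed)
qed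

context asymptotic_angles
begin

text \<open>\<open>h $ 1\<close> times X plus \<open>h $ 2\<close> times Y, with X and Y the
  hyperbolic unit asymptotic vectors: the inverse of the coframe matrix.\<close>

definition frame :: "real^2 \<Rightarrow> real^2 \<Rightarrow> real^2" where
  "frame p h = (1 / conf p) *\<^sub>R (h $ 1 *\<^sub>R direction (\<beta> p) + h $ 2 *\<^sub>R direction (\<gamma> p))"

lemma frame_component:
  "frame p h $ 1 = (h $ 1 * cos (\<beta> p) + h $ 2 * cos (\<gamma> p)) / conf p"
  "frame p h $ 2 = (h $ 1 * sin (\<beta> p) + h $ 2 * sin (\<gamma> p)) / conf p"
  by (simp_all add: frame_def)

lemma linear_frame: "linear (frame p)"
  by (auto simp: linear_iff frame_def algebra_simps)

text \<open>The left side is the hyperbolic length. The bound is free of \<Theta>, so nearly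
  parallel asymptotic directions do no harm.\<close>

lemma frame_bound:
  assumes "p \<in> poincare_disk"
  shows "conf p * norm (frame p h) \<le> 2 * norm h"
proof -
  have "conf p * norm (frame p h) = norm (h $ 1 *\<^sub>R direction (\<beta> p) + h $ 2 *\<^sub>R direction (\<gamma> p))"
    using conf_pos[OF assms] by (simp add: frame_def)
  also have "\<dots> \<le> \<bar>h $ 1\<bar> + \<bar>h $ 2\<bar>"
    using norm_triangle_ineq[of "h $ 1 *\<^sub>R direction (\<beta> p)" "h $ 2 *\<^sub>R direction (\<gamma> p)"] by simp
  also have "\<dots> \<le> 2 * norm h"
    using component_le_norm_cart[of h 1] component_le_norm_cart[of h 2] by simp
  finally show ?thesis .
qed

lemma Chebyshev_parametrization:
  obtains x :: "real^2 \<Rightarrow> real^2"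
    where "\<And>z. x z \<in> poincare_disk" "\<And>z. (x has_derivative frame (x z)) (at z)"
proof -
  let ?D = poincare_disk
  obtain u where u: "smooth u" "\<And>p. p \<in> ?D \<Longrightarrow> (u has_derivative (\<lambda>v. v $ 1 * U1 p + v $ 2 * U2 p)) (at p)"
    using potential_on_disk[OF smooth_coframe(1,2) closed_U] by blast
  obtain w where w: "smooth w" "\<And>p. p \<in> ?D \<Longrightarrow> (w has_derivative (\<lambda>v. v $ 1 * W1 p + v $ 2 * W2 p)) (at p)"
    using potential_on_disk[OF smooth_coframe(3,4) closed_W] by blast
  \<comment> \<open>The constants normalize \<open>F\<close> to vanish at the base point 0.\<close>
  define F :: "real^2 \<Rightarrow> real^2" where "F p = (u p - u 0) *\<^sub>R axis 1 1 + (w p - w 0) *\<^sub>R axis 2 (1::real)" for p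
  define F' :: "real^2 \<Rightarrow> real^2 \<Rightarrow> real^2" where "F' p v = (v $ 1 * U1 p + v $ 2 * U2 p) *\<^sub>R axis 1 1
    + (v $ 1 * W1 p + v $ 2 * W2 p) *\<^sub>R axis 2 (1::real)" for p v
  have SF: "smooth F" unfolding F_def[abs_def] by (intro disk_smooth_intros u w)
  have F': "(F has_derivative F' p) (at p)" if p: "p \<in> ?D" for p
  proof -
    have "((\<lambda>p. u p - u 0) has_derivative (\<lambda>v. v $ 1 * U1 p + v $ 2 * U2 p - 0)) (at p)"
      "((\<lambda>p. w p - w 0) has_derivative (\<lambda>v. v $ 1 * W1 p + v $ 2 * W2 p - 0)) (at p)"
      by (intro has_derivative_diff u w p has_derivative_const)+
    then show ?thesis
      unfolding F_def[abs_def] F'_def[abs_def] by (intro has_derivative_add has_derivative_scaleR_left) simp_all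
  qed
  have inverse: "frame p (F' p v) = v" if p: "p \<in> ?D" for p v
  proof -
    have "conf p \<noteq> 0" using conf_pos[OF p] by simp
    have F'_comp: "F' p v $ 1 = v $ 1 * U1 p + v $ 2 * U2 p" "F' p v $ 2 = v $ 1 * W1 p + v $ 2 * W2 p"
      by (simp_all add: F'_def axis_def)
    have S: "sin (\<Theta> p) = sin (\<gamma> p) * cos (\<beta> p) - cos (\<gamma> p) * sin (\<beta> p)" by (rule sin_diff)
    have "(F' p v $ 1 * cos (\<beta> p) + F' p v $ 2 * cos (\<gamma> p)) * sin (\<Theta> p) = conf p * v $ 1 * sin (\<Theta> p)"
      "(F' p v $ 1 * sin (\<beta> p) + F' p v $ 2 * sin (\<gamma> p)) * sin (\<Theta> p) = conf p * v $ 2 * sin (\<Theta> p)"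
      using sin_\<Theta>_ne[of p]
      by (simp_all add: F'_comp U1_def U2_def W1_def W2_def field_simps) (simp_all add: S algebra_simps)
    then have "frame p (F' p v) $ 1 = v $ 1" "frame p (F' p v) $ 2 = v $ 2"
      using sin_\<Theta>_ne[of p] \<open>conf p \<noteq> 0\<close> by (simp_all add: frame_component)
    then show ?thesis by (simp add: vec_eq_iff forall_2)
  qed
  \<comment> \<open>The exhaustion function has derivative \<open>conf p * (p \<bullet> v)\<close>,
    at most the hyperbolic length of \<open>v\<close> because \<open>norm p < 1\<close>;
    \<open>frame_bound\<close> then gives \<open>C = 2\<close>. The same bound and
    \<open>conf \<ge> 1\<close> give \<open>B = 2\<close>.\<close>
  interpret expanding_local_homeo ?D F F' frame "\<lambda>p. - ln (1 - (p$1)\<^sup>2 - (p$2)\<^sup>2)"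
    "\<lambda>p v. conf p * (p $ 1 * v $ 1 + p $ 2 * v $ 2)" 2 2 0
  proof (rule expanding_local_homeo.intro)
    show "open ?D" "0 \<in> ?D" by (rule open_poincare_disk zero_in_poincare_disk)+
    show "F 0 = 0" by (simp add: F_def)
    show "compact {p \<in> ?D. - ln (1 - (p$1)\<^sup>2 - (p$2)\<^sup>2) \<le> M}" for M
      by (rule compact_disk_sublevel)
    fix p assume p: "p \<in> ?D"
    show "(F has_derivative F' p) (at p)" by (rule F'[OF p])
    show "\<exists>r>0. inj_on F (ball p r)"
      using inverse[OF p] frechet_derivative_at[OF F'[OF p]]
      by (intro smooth_locally_injective[OF open_poincare_disk p SF linear_frame[of p]]) metis
    show "linear (frame p)" by (rule linear_frame)
    show "frame p (F' p v) = v" for v by (rule inverse[OF p])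
    have "norm (frame p v) \<le> conf p * norm (frame p v)" for v
      using mult_right_mono[of 1 "conf p" "norm (frame p v)"] conf_ge_2[OF p] by simp
    then show "norm (frame p v) \<le> 2 * norm v" for v
      using frame_bound[OF p] order_trans by blast
    show "((\<lambda>p. - ln (1 - (p$1)\<^sup>2 - (p$2)\<^sup>2)) has_derivative
        (\<lambda>v. conf p * (p $ 1 * v $ 1 + p $ 2 * v $ 2))) (at p)"
      using conf_denominator[OF p]
      by (auto intro!: derivative_eq_intros bounded_linear.has_derivative[OF bounded_linear_vec_nth]
          simp: conf_def field_simps)
    show "\<bar>conf p * (p $ 1 * frame p v $ 1 + p $ 2 * frame p v $ 2)\<bar> \<le> 2 * norm v" for v
    proof -
      have "\<bar>p \<bullet> frame p v\<bar> \<le> norm p * norm (frame p v)" by (rule Cauchy_Schwarz_ineq2)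
      also have "\<dots> \<le> 1 * norm (frame p v)"
        using p by (intro mult_right_mono) (auto simp: poincare_disk_eq_ball)
      finally have *: "\<bar>p \<bullet> frame p v\<bar> \<le> norm (frame p v)" by simp
      have "\<bar>conf p * (p $ 1 * frame p v $ 1 + p $ 2 * frame p v $ 2)\<bar> = conf p * \<bar>p \<bullet> frame p v\<bar>"
        using conf_pos[OF p] by (simp add: abs_mult inner_vec_def sum_2)
      also have "\<dots> \<le> conf p * norm (frame p v)"
        using * conf_pos[OF p] by (intro mult_left_mono) auto
      also have "\<dots> \<le> 2 * norm v" by (rule frame_bound[OF p])
      finally show ?thesis .
    qed
  qed auto
  show thesis by (rule global_section) (rule that)
qed

lemma contradiction: False
proof -
  obtain x :: "real^2 \<Rightarrow> real^2" where x: "\<And>z. x z \<in> poincare_disk" "\<And>z. (x has_derivative frame (x z)) (at z)"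
    using Chebyshev_parametrization by blast
  define z :: "real \<Rightarrow> real \<Rightarrow> real^2" where "z u v = u *\<^sub>R axis 1 1 + v *\<^sub>R axis 2 (1::real)" for u v
  \<comment> \<open>Chain rule: since the derivative of \<open>x\<close> is \<open>frame\<close>,
    the coordinate derivatives in \<open>u\<close> and \<open>v\<close> are the derivatives along X
    and Y.\<close>
  have deriv: "((\<lambda>u. f (x (z u v))) has_real_derivative
      (partial 1 f (x (z u v)) * cos (\<beta> (x (z u v))) + partial 2 f (x (z u v)) * sin (\<beta> (x (z u v)))) / conf (x (z u v))) (at u)"
    "((\<lambda>v. f (x (z u v))) has_real_derivative
      (partial 1 f (x (z u v)) * cos (\<gamma> (x (z u v))) + partial 2 f (x (z u v)) * sin (\<gamma> (x (z u v)))) / conf (x (z u v))) (at v)"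
    if "smooth f" for f u v
  proof -
    have D: "((\<lambda>w. f (x w)) has_derivative (\<lambda>h. frame (x (z u v)) h $ 1 *\<^sub>R partial 1 f (x (z u v))
        + frame (x (z u v)) h $ 2 *\<^sub>R partial 2 f (x (z u v)))) (at (z u v))"
      by (rule has_derivative_compose[OF x(2) has_derivative_partial[OF that x(1)]])
    have "((\<lambda>u. z u v) has_derivative (\<lambda>k. k *\<^sub>R axis 1 1)) (at u)"
      "((\<lambda>v. z u v) has_derivative (\<lambda>k. k *\<^sub>R axis 2 1)) (at v)"
      unfolding z_def by (auto intro!: derivative_eq_intros)
    from has_derivative_compose[OF this(1) D] has_derivative_compose[OF this(2) D]
    show "((\<lambda>u. f (x (z u v))) has_real_derivative
      (partial 1 f (x (z u v)) * cos (\<beta> (x (z u v))) + partial 2 f (x (z u v)) * sin (\<beta> (x (z u v)))) / conf (x (z u v))) (at u)"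
    "((\<lambda>v. f (x (z u v))) has_real_derivative
      (partial 1 f (x (z u v)) * cos (\<gamma> (x (z u v))) + partial 2 f (x (z u v)) * sin (\<gamma> (x (z u v)))) / conf (x (z u v))) (at v)"
      by (auto elim!: has_derivative_imp_has_field_derivative simp: frame_component axis_def add_divide_distrib algebra_simps)
  qed
  show False
  proof (rule no_sine_Gordon_solution[of "\<lambda>u v. \<Theta> (x (z u v))" "\<lambda>u v. P (x (z u v))"])
    show "0 < \<Theta> (x (z u v))" "\<Theta> (x (z u v)) < pi" for u v by (rule angle_range)+
    have "smooth (\<lambda>p. \<Theta> p)" by (intro disk_smooth_intros smooth_angle)
    from deriv(1)[OF this]
    show "((\<lambda>u. \<Theta> (x (z u v))) has_real_derivative P (x (z u v))) (at u)" for u v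
      by (simp add: P_eq_derivative_\<Theta>[OF x(1)])
    show "((\<lambda>v. P (x (z u v))) has_real_derivative sin (\<Theta> (x (z u v)))) (at v)" for u v
      using deriv(2)[OF smooth_P] by (simp add: derivative_P[OF x(1)])
    show "isCont (\<lambda>u. P (x (z u v))) u" for u v
      using deriv(1)[OF smooth_P] DERIV_isCont by blast
  qed
qed

end

theorem theorem1:
  shows "\<not> (\<exists>\<phi> :: real^2 \<Rightarrow> real^3. smooth_isometric_immersion poincare_disk poincare_metric \<phi>)"
proof
  assume "\<exists>\<phi> :: real^2 \<Rightarrow> real^3. smooth_isometric_immersion poincare_disk poincare_metric \<phi>"
  then obtain \<phi> :: "real^2 \<Rightarrow> real^3" where "smooth_isometric_immersion poincare_disk poincare_metric \<phi>" ..
  then obtain a b c where abc: "smooth a" "smooth b" "smooth c"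
    "\<And>p. p \<in> poincare_disk \<Longrightarrow> a p * c p - (b p)\<^sup>2 = - (conf p)\<^sup>2"
    "\<And>p. p \<in> poincare_disk \<Longrightarrow>
      partial 1 b p - partial 2 a p = - conf p * p $ 2 * c p - conf p * p $ 1 * b p"
    "\<And>p. p \<in> poincare_disk \<Longrightarrow>
      partial 1 c p - partial 2 b p = conf p * p $ 1 * a p + conf p * p $ 2 * b p"
    using Gauss_Codazzi by metis
  obtain \<beta> \<gamma> where "smooth \<beta>" "smooth \<gamma>"
    "\<And>p. 0 < \<gamma> p - \<beta> p" "\<And>p. \<gamma> p - \<beta> p < pi"
    "\<And>p. p \<in> poincare_disk \<Longrightarrow> a p * sin (\<gamma> p - \<beta> p) = conf p * (- 2 * sin (\<beta> p) * sin (\<gamma> p))"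
    "\<And>p. p \<in> poincare_disk \<Longrightarrow> b p * sin (\<gamma> p - \<beta> p) = conf p * sin (\<beta> p + \<gamma> p)"
    "\<And>p. p \<in> poincare_disk \<Longrightarrow> c p * sin (\<gamma> p - \<beta> p) = conf p * (- 2 * cos (\<beta> p) * cos (\<gamma> p))"
    using asymptotic_angles[OF abc(1-4)] by metis
  with abc interpret asymptotic_angles a b c \<beta> \<gamma>
    by unfold_locales
  show False by (rule contradiction)
qed

end
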